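(* Let $d\ge 2$ and let $\Phi$ be a completely positive, trace-preserving, unital linear map on the $d\times d$ complex matrices, with normalised state representative (Choi matrix) $\rho=(\Phi\otimes\mathrm{id})(|I\rangle\langle I|)$, where $|I\rangle=\frac{1}{\sqrt d}\sum_{i=1}^d|i,i\rangle\in\mathbb{C}^d\otimes\mathbb{C}^d$. Define the $d^2\times d^2$ matrices $A_i:=\rho^{1/2}(\tau_i\otimes\mathbb{1})\rho^{1/2}$ for $1\le i\le d^2-1$. Then $\Phi$ is a random unitary map if and only if there exist an integer $K\ge d^2$ and a right-unitary $d^2\times K$ matrix $T$ such that $$(T^\dagger A_iT)_{jj}=0\quad\text{for all }1\le i\le d^2-1,\ 1\le j\le K.$$
   Context: A linear map $\Phi$ on $d\times d$ matrices is a random unitary map if $\Phi(\rho)=\sum_i p_iU_i\rho U_i^\dagger$ for all $\rho$, for some finite probability distribution $(p_i)$ and unitary $d\times d$ matrices $U_i$. Unital means $\Phi(\mathbb{1})=\mathbb{1}$. A matrix $T$ (not necessarily square) is right-unitary if $TT^\dagger=\mathbb{1}$. The matrices $\tau_1,\dots,\tau_{d^2-1}$ are the following traceless Hermitian $d\times d$ matrices (generalised Pauli/Gell-Mann matrices), in any fixed order: $|k\rangle\langle l|+|l\rangle\langle k|$ for $1\le k<l\le d$; $i(|k\rangle\langle l|-|l\rangle\langle k|)$ for $1\le k<l\le d$; and $\sqrt{\tfrac{2}{k^2+k}}\,\mathrm{Diag}(1,\dots,1,-k,0,\dots,0)$ ($k$ ones, then $-k$, then $d-k-1$ zeros) for $1\le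 k\le d-1$. They satisfy $\mathrm{Tr}[\tau_i\tau_j]=2\delta_{ij}$. *)

theory Defs
  imports "Jordan_Normal_Form.Schur_Decomposition"
begin

subsection \<open>Matrices\<close>

definition mat_trace :: "complex mat \<Rightarrow> complex" where
  "mat_trace A = (\<Sum>i<dim_row A. A $$ (i, i))"

definition unitary_mat :: "nat \<Rightarrow> complex mat \<Rightarrow> bool" where
  "unitary_mat d U \<longleftrightarrow> U \<in> carrier_mat d d \<and> U * mat_adjoint U = 1\<^sub>m d \<and> mat_adjoint U * U = 1\<^sub>m d"

definition right_unitary :: "complex mat \<Rightarrow> bool" where
  "right_unitary T \<longleftrightarrow> T * mat_adjoint T = 1\<^sub>m (dim_row T)"

(* The order on complex numbers is that of HOL-Library.Complex_Order:
   0 \<le> z means that z is real and nonnegative. *)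
definition psd_mat :: "nat \<Rightarrow> complex mat \<Rightarrow> bool" where
  "psd_mat n A \<longleftrightarrow> A \<in> carrier_mat n n \<and> mat_adjoint A = A \<and>
     (\<forall>v \<in> carrier_vec n. 0 \<le> (A *\<^sub>v v) \<bullet>c v)"

definition psd_sqrt :: "complex mat \<Rightarrow> complex mat" where
  "psd_sqrt A = (THE B. psd_mat (dim_row A) B \<and> B * B = A)"

(* Throughout, the basis vector e_i (x) e_a of C^m (x) C^n has index i * n + a (counting from 0). *)
definition kron :: "complex mat \<Rightarrow> complex mat \<Rightarrow> complex mat" where
  "kron A B = mat (dim_row A * dim_row B) (dim_col A * dim_col B)
     (\<lambda>(r, c). A $$ (r div dim_row B, c div dim_col B) * B $$ (r mod dim_row B, c mod dim_col B))"

definition outer_prod :: "complex vec \<Rightarrow> complex mat" where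
  "outer_prod v = mat (dim_vec v) (dim_vec v) (\<lambda>(r, c). v $ r * cnj (v $ c))"

subsection \<open>Maps on matrices\<close>

(* Maps on d x d matrices are functions on the whole type of matrices; only their values on
   carrier_mat d d are constrained or used. *)
definition linear_mat_map :: "nat \<Rightarrow> (complex mat \<Rightarrow> complex mat) \<Rightarrow> bool" where
  "linear_mat_map d \<Phi> \<longleftrightarrow>
     (\<forall>A \<in> carrier_mat d d. \<Phi> A \<in> carrier_mat d d) \<and>
     (\<forall>A \<in> carrier_mat d d. \<forall>B \<in> carrier_mat d d. \<Phi> (A + B) = \<Phi> A + \<Phi> B) \<and>
     (\<forall>A \<in> carrier_mat d d. \<forall>c. \<Phi> (c \<cdot>\<^sub>m A) = c \<cdot>\<^sub>m \<Phi> A)"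

(* The ampliation of \<Phi> by the identity on n x n matrices: writing X as the sum over a, b of
   X_ab (x) E_ab with X_ab of size d x d, the result is the sum of \<Phi>(X_ab) (x) E_ab. *)
definition tensor_id :: "nat \<Rightarrow> nat \<Rightarrow> (complex mat \<Rightarrow> complex mat) \<Rightarrow> complex mat \<Rightarrow> complex mat" where
  "tensor_id d n \<Phi> X = mat (d * n) (d * n)
     (\<lambda>(r, c). \<Phi> (mat d d (\<lambda>(k, l). X $$ (k * n + r mod n, l * n + c mod n))) $$ (r div n, c div n))"

lemma tensor_id_kron:
  assumes \<Phi>: "linear_mat_map d \<Phi>" and A: "A \<in> carrier_mat d d" and B: "B \<in> carrier_mat n n"
  shows "tensor_id d n \<Phi> (kron A B) = kron (\<Phi> A) B"
proof -
  have \<Phi>A: "\<Phi> A \<in> carrier_mat d d" using \<Phi> A by (auto simp: linear_mat_map_def)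
  show ?thesis
  proof (rule eq_matI)
    fix r c assume "r < dim_row (kron (\<Phi> A) B)" "c < dim_col (kron (\<Phi> A) B)"
    then have r: "r < d * n" and c: "c < d * n" using \<Phi>A B by (auto simp: kron_def)
    then have n: "n > 0" by (cases n) auto
    have bound: "k * n + a mod n < d * n" if "k < d" for k a
    proof -
      have "k * n + a mod n < Suc k * n" using n by simp
      also have "\<dots> \<le> d * n" using that by (intro mult_right_mono) auto
      finally show ?thesis .
    qed
    have rd: "r div n < d" "c div n < d" using r c by (auto simp: less_mult_imp_div_less)
    have "mat d d (\<lambda>(k, l). kron A B $$ (k * n + r mod n, l * n + c mod n))
        = B $$ (r mod n, c mod n) \<cdot>\<^sub>m A"
      using A B n by (intro eq_matI) (auto simp: kron_def bound)
    then show "tensor_id d n \<Phi> (kron A B) $$ (r, c) = kron (\<Phi> A) B $$ (r, c)"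
      using r c A B \<Phi>A rd \<Phi> by (auto simp: tensor_id_def kron_def linear_mat_map_def)
  qed (use \<Phi>A B in \<open>auto simp: tensor_id_def kron_def\<close>)
qed

definition completely_positive :: "nat \<Rightarrow> (complex mat \<Rightarrow> complex mat) \<Rightarrow> bool" where
  "completely_positive d \<Phi> \<longleftrightarrow>
     (\<forall>n X. psd_mat (d * n) X \<longrightarrow> psd_mat (d * n) (tensor_id d n \<Phi> X))"

definition trace_preserving :: "nat \<Rightarrow> (complex mat \<Rightarrow> complex mat) \<Rightarrow> bool" where
  "trace_preserving d \<Phi> \<longleftrightarrow> (\<forall>A \<in> carrier_mat d d. mat_trace (\<Phi> A) = mat_trace A)"

definition unital :: "nat \<Rightarrow> (complex mat \<Rightarrow> complex mat) \<Rightarrow> bool" where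
  "unital d \<Phi> \<longleftrightarrow> \<Phi> (1\<^sub>m d) = 1\<^sub>m d"

definition random_unitary :: "nat \<Rightarrow> (complex mat \<Rightarrow> complex mat) \<Rightarrow> bool" where
  "random_unitary d \<Phi> \<longleftrightarrow>
     (\<exists>m (p :: nat \<Rightarrow> real) U.
        (\<forall>i<m. 0 \<le> p i) \<and> (\<Sum>i<m. p i) = 1 \<and> (\<forall>i<m. unitary_mat d (U i)) \<and>
        (\<forall>\<rho> \<in> carrier_mat d d. \<Phi> \<rho> =
           mat d d (\<lambda>(r, c). \<Sum>i<m. complex_of_real (p i) * (U i * \<rho> * mat_adjoint (U i)) $$ (r, c))))"

definition max_entangled :: "nat \<Rightarrow> complex vec" where
  "max_entangled d =
     vec (d * d) (\<lambda>r. if r div d = r mod d then complex_of_real (1 / sqrt (real d)) else 0)"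

definition choi :: "nat \<Rightarrow> (complex mat \<Rightarrow> complex mat) \<Rightarrow> complex mat" where
  "choi d \<Phi> = tensor_id d d \<Phi> (outer_prod (max_entangled d))"

subsection \<open>Generalised Gell-Mann matrices\<close>

(* |k><l|, with rows and columns counted from 0 *)
definition mat_unit :: "nat \<Rightarrow> nat \<Rightarrow> nat \<Rightarrow> complex mat" where
  "mat_unit d k l = mat d d (\<lambda>(r, c). if r = k \<and> c = l then 1 else 0)"

definition gm_sym :: "nat \<Rightarrow> nat \<Rightarrow> nat \<Rightarrow> complex mat" where
  "gm_sym d k l = mat_unit d k l + mat_unit d l k"

definition gm_asym :: "nat \<Rightarrow> nat \<Rightarrow> nat \<Rightarrow> complex mat" where
  "gm_asym d k l = \<i> \<cdot>\<^sub>m (mat_unit d k l - mat_unit d l k)"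

definition gm_diag :: "nat \<Rightarrow> nat \<Rightarrow> complex mat" where
  "gm_diag d k = complex_of_real (sqrt (2 / (real k ^ 2 + real k))) \<cdot>\<^sub>m
     mat_diag d (\<lambda>r. if r < k then 1 else if r = k then - of_nat k else 0)"

definition gell_mann :: "nat \<Rightarrow> complex mat set" where
  "gell_mann d = {gm_sym d k l | k l. k < l \<and> l < d} \<union> {gm_asym d k l | k l. k < l \<and> l < d}
     \<union> {gm_diag d k | k. 1 \<le> k \<and> k \<le> d - 1}"

(* The three families are pairwise distinct, so gell_mann d can indeed be enumerated as
   \<tau>_1, ..., \<tau>_(d^2 - 1). *)
lemma card_gell_mann:
  assumes d: "d \<ge> 1"
  shows "card (gell_mann d) = d\<^sup>2 - 1"
proof -
  define I where "I = {..<d} \<times> {..<d} - {(0::nat, 0::nat)}"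
  define g where "g = (\<lambda>(k, l). if k < l then gm_sym d k l else if l < k then gm_asym d l k
                                else gm_diag d k)"
  have entries: "gm_sym d k l $$ (r, c) = (if r = k \<and> c = l \<or> r = l \<and> c = k then 1 else 0)"
    "gm_asym d k l $$ (r, c) = (if r = k \<and> c = l then \<i> else if r = l \<and> c = k then - \<i> else 0)"
    if "k < l" "l < d" "r < d" "c < d" for k l r c
    using that by (auto simp: gm_sym_def gm_asym_def mat_unit_def)
  have diag: "gm_diag d k $$ (r, c) = (if r = c then complex_of_real (sqrt (2 / (real k ^ 2 + real k))) *
      (if r < k then 1 else if r = k then - of_nat k else 0) else 0)"
    if "r < d" "c < d" for k r c
    using that by (auto simp: gm_diag_def mat_diag_def)
  have diag_inj: "k = k'" if k: "0 < k" "k < d" "0 < k'" "k' < d" and eq: "gm_diag d k = gm_diag d k'" for k k'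
  proof (rule ccontr)
    assume "k \<noteq> k'"
    have nz: "sqrt (2 / (real j ^ 2 + real j)) \<noteq> 0" if "0 < j" for j
    proof -
      have "real j ^ 2 + real j > 0" using that by (simp add: add_pos_pos)
      then show ?thesis by simp
    qed
    have "gm_diag d k $$ (max k k', max k k') = gm_diag d k' $$ (max k k', max k k')"
      using eq by simp
    then show False using k \<open>k \<noteq> k'\<close> nz[of k] nz[of k']
      by (cases "k < k'") (auto simp: diag max_def split: if_splits simp del: real_sqrt_eq_zero_cancel_iff)
  qed
  have "inj_on g I"
  proof (rule inj_onI, clarify)
    fix k l k' l' assume I: "(k, l) \<in> I" "(k', l') \<in> I" and eq: "g (k, l) = g (k', l')"
    have b: "k < d" "l < d" "k' < d" "l' < d" using I by (auto simp: I_def)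
    have e: "g (k, l) $$ (r, c) = g (k', l') $$ (r, c)" for r c using eq by simp
    have off: "g (k, l) $$ (r, c) =
        (if k \<noteq> l \<and> (r = k \<and> c = l \<or> r = l \<and> c = k)
         then if k < l then 1 else if r = k then - \<i> else \<i> else 0)"
      if "k < d" "l < d" "r < d" "c < d" "r \<noteq> c" for k l r c
    proof -
      consider "k < l" | "l < k" | "k = l" by linarith
      then show ?thesis using that by cases (auto simp: g_def entries diag)
    qed
    have half: "k' = k \<and> l' = l"
      if neq: "k \<noteq> l" and that: "k < d" "l < d" "k' < d" "l' < d" "g (k, l) $$ (k, l) = g (k', l') $$ (k, l)" for k l k' l'
    proof -
      consider "k < l" | "l < k" using neq by linarith
      then show ?thesis
        using that by cases (auto simp: off complex_eq_iff split: if_splits)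
    qed
    show "k = k' \<and> l = l'"
    proof (cases "k = l")
      case False
      then show ?thesis using half[of k l k' l'] b e by auto
    next
      case kl: True
      show ?thesis
      proof (cases "k' = l'")
        case False
        then show ?thesis using half[of k' l' k l] b e by auto
      next
        case True
        then show ?thesis using kl diag_inj[of k k'] I eq b by (auto simp: I_def g_def)
      qed
    qed
  qed
  moreover have "g ` I = gell_mann d"
  proof
    show "g ` I \<subseteq> gell_mann d"
    proof clarify
      fix k l assume I: "(k, l) \<in> I"
      consider "k < l" | "l < k" | "k = l" by linarith
      then show "g (k, l) \<in> gell_mann d"
      proof cases
        case 1
        then show ?thesis using I unfolding g_def I_def gell_mann_def by auto
      next
        case 2
        then show ?thesis using I unfolding g_def I_def gell_mann_def by auto
      next
        case 3
        then have "1 \<le> k \<and> k \<le> d - 1" using I by (auto simp: I_def)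
        then show ?thesis using 3 unfolding g_def gell_mann_def by auto
      qed
    qed
    have "gm_sym d k l \<in> g ` I" if "k < l" "l < d" for k l
      using that by (intro image_eqI[of _ _ "(k, l)"]) (auto simp: g_def I_def)
    moreover have "gm_asym d k l \<in> g ` I" if "k < l" "l < d" for k l
      using that by (intro image_eqI[of _ _ "(l, k)"]) (auto simp: g_def I_def)
    moreover have "gm_diag d k \<in> g ` I" if "1 \<le> k" "k \<le> d - 1" for k
      using that by (intro image_eqI[of _ _ "(k, k)"]) (auto simp: g_def I_def)
    ultimately show "gell_mann d \<subseteq> g ` I" by (auto simp: gell_mann_def)
  qed
  moreover have "card I = d\<^sup>2 - 1"
    using d by (simp add: I_def power2_eq_square)
  ultimately show ?thesis using card_image[of g I] by simp
qed

end

(* Write X' for the adjoint of X, and let S be the square root of the Choi matrix. The factorisations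
   S S = M M' correspond to the Kraus decompositions of the map: the k-th column of M, reshaped into
   a d x d matrix V_k and multiplied by sqrt d, is the k-th Kraus operator. For M = S T with T
   right-unitary, the diagonal entry (T' A_i T)_jj is Tr(tau_i V_j V_j'), so these entries all vanish
   iff every V_j V_j' is a multiple of the identity, i.e. every V_j is a multiple of a unitary.
   Conversely, any M with M M' = S S is, up to appended zero columns, of the form S T: take
   T = [S^+ M | P], where S^+ is the pseudo-inverse of S and P the projection onto its kernel. *)
theory Submission
  imports Defs "Jordan_Normal_Form.Spectral_Radius"
begin

text \<open>Two obstacles shape the proof. First, \<open>psd_sqrt\<close> is a definite description,
  so nothing is known about it until the positive square root is shown to exist and to be unique;
  both facts come from the spectral theorem, proved by splitting off one eigenvector at a time.
  Second, S may be singular, so T cannot be S^(-1) M. The block S^+ M alone gives (S^+ M)(S^+ M)' =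
  S^+ S S S^+, the projection onto the range of S; the block P contributes P P' = P, the missing
  projection onto the kernel. The product S [S^+ M | P] is still M padded by zeros: S P = 0, and S
  S^+ M = M because P M (P M)' = P S S P = 0 forces P M = 0. The padding is harmless, since V_j V_j'
  = 0 is the multiple 0 of the identity. The trace formula rests on (B (x) 1) vec V = vec (B V), and
  unitality is what makes the weights of the unitaries add up to 1.\<close>

subsection \<open>Adjoints and unitary matrices\<close>

lemma dim_mat_adjoint [simp]:
  "dim_row (mat_adjoint A) = dim_col A" "dim_col (mat_adjoint A) = dim_row A"
  by (auto simp: mat_adjoint_def)

lemma mat_adjoint_carrier [simp, intro]:
  "A \<in> carrier_mat n m \<Longrightarrow> mat_adjoint A \<in> carrier_mat m n"
  by auto

lemma index_mat_adjoint [simp]: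
  fixes A :: "complex mat"
  assumes "i < dim_col A" "j < dim_row A"
  shows "mat_adjoint A $$ (i, j) = cnj (A $$ (j, i))"
  using assms by (simp add: mat_adjoint_def mat_of_rows_index)

lemma index_mult_sum:
  fixes A B :: "complex mat"
  assumes "A \<in> carrier_mat n m" "B \<in> carrier_mat m k" "i < n" "j < k"
  shows "(A * B) $$ (i, j) = (\<Sum>l<m. A $$ (i, l) * B $$ (l, j))"
  using assms by (auto simp: scalar_prod_def atLeast0LessThan)

lemma mat_adjoint_adjoint [simp]: "mat_adjoint (mat_adjoint A) = (A :: complex mat)"
  by (rule eq_matI) auto

lemma mat_adjoint_one [simp]: "mat_adjoint (1\<^sub>m n) = (1\<^sub>m n :: complex mat)"
  by (rule eq_matI) auto

lemma mat_adjoint_mult: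
  fixes A B :: "complex mat"
  assumes "A \<in> carrier_mat n m" "B \<in> carrier_mat m k"
  shows "mat_adjoint (A * B) = mat_adjoint B * mat_adjoint A"
  using assms
  by (intro eq_matI) (auto simp: index_mult_sum[OF assms]
      index_mult_sum[OF mat_adjoint_carrier[OF assms(2)] mat_adjoint_carrier[OF assms(1)]] mult.commute
      simp del: index_mult_mat(1))

lemma mat_adjoint_diag [simp]:
  "mat_adjoint (mat_diag n f) = mat_diag n (\<lambda>i. cnj (f i))"
  by (rule eq_matI) (auto simp: mat_diag_def)

lemma cscalar_prod_adjoint:
  fixes C :: "complex mat"
  assumes "C \<in> carrier_mat n m" "w \<in> carrier_vec m" "v \<in> carrier_vec n"
  shows "(C *\<^sub>v w) \<bullet>c v = w \<bullet>c (mat_adjoint C *\<^sub>v v)"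
proof -
  have "(C *\<^sub>v w) \<bullet>c v = (\<Sum>i<n. \<Sum>j<m. C $$ (i, j) * w $ j * cnj (v $ i))"
    using assms by (simp add: scalar_prod_def atLeast0LessThan sum_distrib_right)
  also have "\<dots> = (\<Sum>j<m. \<Sum>i<n. C $$ (i, j) * w $ j * cnj (v $ i))"
    by (rule sum.swap)
  also have "\<dots> = w \<bullet>c (mat_adjoint C *\<^sub>v v)"
    using assms by (simp add: scalar_prod_def atLeast0LessThan sum_distrib_left mult_ac)
  finally show ?thesis .
qed

lemma index_adjoint_mult_mult:
  fixes A U W :: "complex mat"
  assumes "U \<in> carrier_mat n m" "A \<in> carrier_mat n n" "W \<in> carrier_mat n k" "i < m" "j < k"
  shows "(mat_adjoint U * A * W) $$ (i, j) = (A *\<^sub>v col W j) \<bullet>c col U i"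
proof -
  have "(mat_adjoint U * A * W) $$ (i, j) = (mat_adjoint U * (A * W)) $$ (i, j)"
    using assms by (simp add: assoc_mult_mat[of _ m n _ n _ k])
  also have "\<dots> = (\<Sum>l<n. mat_adjoint U $$ (i, l) * (A * W) $$ (l, j))"
    using assms by (intro index_mult_sum[of _ m n _ k]) auto
  also have "\<dots> = (A *\<^sub>v col W j) \<bullet>c col U i"
    using assms by (auto simp: scalar_prod_def atLeast0LessThan intro!: sum.cong)
  finally show ?thesis .
qed

lemma unitary_matI:
  assumes "U \<in> carrier_mat n n" "mat_adjoint U * U = 1\<^sub>m n"
  shows "unitary_mat n U"
  using assms mat_mult_left_right_inverse[of "mat_adjoint U" n U] by (auto simp: unitary_mat_def)

lemma unitary_mat_mult:
  assumes "unitary_mat n U" "unitary_mat n V"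
  shows "unitary_mat n (U * V)"
proof (rule unitary_matI)
  have U: "U \<in> carrier_mat n n" "mat_adjoint U * U = 1\<^sub>m n"
    and V: "V \<in> carrier_mat n n" "mat_adjoint V * V = 1\<^sub>m n"
    using assms by (auto simp: unitary_mat_def)
  show "U * V \<in> carrier_mat n n" using U V by auto
  have "mat_adjoint (U * V) * (U * V) = mat_adjoint V * (mat_adjoint U * U) * V"
    using U(1) V(1) by (simp add: mat_adjoint_mult[of _ n n _ n] assoc_mult_mat[of _ n n _ n _ n]
        mult_carrier_mat[of _ n n _ n])
  then show "mat_adjoint (U * V) * (U * V) = 1\<^sub>m n"
    using U V by simp
qed

subsection \<open>Diagonalisation of Hermitian matrices\<close>

text \<open>The block-diagonal sum of the 1 x 1 block e and B. It is the shape that remains after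
  one eigenvector of a Hermitian matrix has been split off.\<close>

definition bordered :: "complex \<Rightarrow> complex mat \<Rightarrow> complex mat" where
  "bordered e B = mat (Suc (dim_row B)) (Suc (dim_col B))
     (\<lambda>(i, j). if i = 0 \<or> j = 0 then if i = j then e else 0 else B $$ (i - 1, j - 1))"

lemma bordered_carrier: "B \<in> carrier_mat n m \<Longrightarrow> bordered e B \<in> carrier_mat (Suc n) (Suc m)"
  by (auto simp: bordered_def)

lemma bordered_adjoint: "mat_adjoint (bordered e B) = bordered (cnj e) (mat_adjoint B)"
  by (rule eq_matI) (auto simp: bordered_def)

lemma bordered_mult:
  assumes A: "A \<in> carrier_mat n m" and B: "B \<in> carrier_mat m k"
  shows "bordered a A * bordered b B = bordered (a * b) (A * B)"
proof (rule eq_matI)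
  fix i j assume "i < dim_row (bordered (a * b) (A * B))" "j < dim_col (bordered (a * b) (A * B))"
  then have ij: "i < Suc n" "j < Suc k" using A B by (auto simp: bordered_def)
  have "(bordered a A * bordered b B) $$ (i, j)
      = (\<Sum>l<Suc m. bordered a A $$ (i, l) * bordered b B $$ (l, j))"
    using ij A B by (intro index_mult_sum) (auto intro: bordered_carrier)
  also have "\<dots> = bordered a A $$ (i, 0) * bordered b B $$ (0, j)
      + (\<Sum>l<m. bordered a A $$ (i, Suc l) * bordered b B $$ (Suc l, j))"
    by (rule sum.lessThan_Suc_shift)
  also have "\<dots> = bordered (a * b) (A * B) $$ (i, j)"
  proof (cases "i = 0 \<or> j = 0")
    case True
    then show ?thesis using ij A B by (auto simp: bordered_def)
  next
    case False
    then have "(A * B) $$ (i - 1, j - 1) = (\<Sum>l<m. A $$ (i - 1, l) * B $$ (l, j - 1))"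
      using ij A B by (intro index_mult_sum) auto
    then show ?thesis using False ij A B by (auto simp: bordered_def simp del: index_mult_mat(1))
  qed
  finally show "(bordered a A * bordered b B) $$ (i, j) = bordered (a * b) (A * B) $$ (i, j)" .
qed (use A B in \<open>auto simp: bordered_def\<close>)

lemma bordered_one: "bordered 1 (1\<^sub>m n) = 1\<^sub>m (Suc n)"
  by (rule eq_matI) (auto simp: bordered_def)

lemma bordered_diag: "bordered e (mat_diag n f) = mat_diag (Suc n) (case_nat e f)"
  by (rule eq_matI) (auto simp: bordered_def mat_diag_def split: nat.splits)

text \<open>Every nonempty complex matrix has an eigenvector. Completing it to a basis and applying
  Gram-Schmidt leaves the first vector unchanged, so normalising the resulting vectors gives the
  columns of U.\<close>

lemma exists_unitary_first_col_eigenvector: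
  fixes A :: "complex mat"
  assumes A: "A \<in> carrier_mat n n" and n: "n > 0"
  obtains U e where "unitary_mat n U" "A *\<^sub>v col U 0 = e \<cdot>\<^sub>v col U 0"
proof -
  obtain e where "eigenvalue A e"
    using spectrum_non_empty[OF A] n by (auto simp: spectrum_def)
  then obtain v where v: "v \<in> carrier_vec n" "v \<noteq> 0\<^sub>v n" "A *\<^sub>v v = e \<cdot>\<^sub>v v"
    using A by (auto simp: eigenvalue_def eigenvector_def)
  define b where "b = basis_completion v"
  define ws where "ws = gram_schmidt n b"
  interpret cof_vec_space n "TYPE(complex)" .
  from basis_completion[OF v(1,2), folded b_def]
  have dist_b: "distinct b" and indep: "\<not> lin_dep (set b)" and b: "set b \<subseteq> carrier_vec n"
    and hdb: "hd b = v" and len_b: "length b = n" by auto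
  from hdb len_b n obtain vs where bv: "b = v # vs" by (cases b) auto
  from gram_schmidt_result[OF b dist_b indep refl, folded ws_def]
  have ws: "set ws \<subseteq> carrier_vec n" "corthogonal ws" "length ws = n"
    by (auto simp: len_b)
  have ws0: "ws ! 0 = v"
    using gram_schmidt_hd[OF v(1), of vs] ws(3) n unfolding ws_def bv
    by (metis hd_conv_nth length_greater_0_conv)
  have wc: "ws ! j \<in> carrier_vec n" if "j < n" for j
    using ws that by auto
  \<comment> \<open>Gram-Schmidt delivers orthogonal nonzero vectors that need not have length 1;
    \<open>s j\<close> is the norm of the j-th one.\<close>
  define s where "s j = sqrt (Re (ws ! j \<bullet>c ws ! j))" for j
  have s: "complex_of_real (s j) * complex_of_real (s j) = ws ! j \<bullet>c ws ! j" "s j \<noteq> 0"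
    if "j < n" for j
  proof -
    have "ws ! j \<bullet>c ws ! j \<noteq> 0" "ws ! j \<bullet>c ws ! j \<ge> 0"
      using corthogonalD[OF ws(2), of j j] ws(3) that wc[OF that]
        conjugate_square_ge_0_vec by auto
    then have *: "0 < Re (ws ! j \<bullet>c ws ! j)" "Im (ws ! j \<bullet>c ws ! j) = 0"
      by (auto simp: less_eq_complex_def complex_eq_iff)
    then show "s j \<noteq> 0" by (simp add: s_def)
    show "complex_of_real (s j) * complex_of_real (s j) = ws ! j \<bullet>c ws ! j"
      using * by (simp add: s_def complex_eq_iff)
  qed
  define U where "U = mat n n (\<lambda>(i, j). ws ! j $ i / complex_of_real (s j))"
  have U: "U \<in> carrier_mat n n" by (simp add: U_def)
  have "mat_adjoint U * U = 1\<^sub>m n"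
  proof (rule eq_matI)
    fix i j assume "i < dim_row (1\<^sub>m n :: complex mat)" "j < dim_col (1\<^sub>m n :: complex mat)"
    then have ij: "i < n" "j < n" by auto
    have "(mat_adjoint U * U) $$ (i, j) = (\<Sum>l<n. mat_adjoint U $$ (i, l) * U $$ (l, j))"
      using U ij by (intro index_mult_sum) auto
    also have "\<dots> = (\<Sum>l<n. (ws ! j $ l * cnj (ws ! i $ l)) / complex_of_real (s i * s j))"
      using ij U by (intro sum.cong) (auto simp: U_def)
    also have "\<dots> = (ws ! j \<bullet>c ws ! i) / complex_of_real (s i * s j)"
      using wc[OF ij(1)] wc[OF ij(2)]
      by (simp add: scalar_prod_def atLeast0LessThan sum_divide_distrib)
    also have "\<dots> = (1\<^sub>m n :: complex mat) $$ (i, j)"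
      using ij s[OF ij(1)] corthogonalD[OF ws(2), of j i] ws(3)
      by (cases "i = j") (auto simp flip: s(1))
    finally show "(mat_adjoint U * U) $$ (i, j) = (1\<^sub>m n :: complex mat) $$ (i, j)" .
  qed (use U in auto)
  moreover have "col U 0 = (1 / complex_of_real (s 0)) \<cdot>\<^sub>v v"
    using n ws0 v(1) by (auto simp: U_def)
  then have "A *\<^sub>v col U 0 = e \<cdot>\<^sub>v col U 0"
    using A v by (simp add: mult_mat_vec smult_smult_assoc mult.commute)
  ultimately show ?thesis using that unitary_matI[OF U] by blast
qed

text \<open>Deflation by induction on n: if the first column of W is an eigenvector, then W' A W has
  first column (e, 0, ..., 0), hence also first row (e, 0, ..., 0) by Hermitian symmetry, and the
  remaining block is Hermitian of size n.\<close>

theorem hermitian_diagonalisation: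
  assumes "A \<in> carrier_mat n n" "mat_adjoint A = A"
  obtains U f where "unitary_mat n U"
    "A = U * mat_diag n (\<lambda>i. complex_of_real (f i)) * mat_adjoint U"
proof -
  have "\<exists>U f. unitary_mat n U \<and> A = U * mat_diag n (\<lambda>i. complex_of_real (f i)) * mat_adjoint U"
    using assms
  proof (induction n arbitrary: A)
    case 0
    then show ?case
      by (intro exI[of _ "1\<^sub>m 0"]) (auto simp: unitary_mat_def intro!: eq_matI)
  next
    case (Suc n)
    obtain W e where W: "unitary_mat (Suc n) W" and ev: "A *\<^sub>v col W 0 = e \<cdot>\<^sub>v col W 0"
      using exists_unitary_first_col_eigenvector[OF Suc.prems(1)] by auto
    have Wc: "W \<in> carrier_mat (Suc n) (Suc n)" and WW: "mat_adjoint W * W = 1\<^sub>m (Suc n)"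
      "W * mat_adjoint W = 1\<^sub>m (Suc n)" using W by (auto simp: unitary_mat_def)
    define B where "B = mat_adjoint W * A * W"
    have Bc: "B \<in> carrier_mat (Suc n) (Suc n)" using Wc Suc.prems by (auto simp: B_def)
    have Bh: "mat_adjoint B = B"
      using Wc Suc.prems
      by (simp add: B_def mat_adjoint_mult[of _ "Suc n" "Suc n" _ "Suc n"]
          assoc_mult_mat[of _ "Suc n" "Suc n" _ "Suc n" _ "Suc n"]
          mult_carrier_mat[of _ "Suc n" "Suc n" _ "Suc n"])
    have B0: "B $$ (i, 0) = (if i = 0 then e else 0)" if "i < Suc n" for i
    proof -
      have "B $$ (i, 0) = e * (col W 0 \<bullet>c col W i)"
        using Wc Suc.prems that unfolding B_def
        by (subst index_adjoint_mult_mult) (auto simp: ev)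
      \<comment> \<open>The inner products of columns of W are the entries of W' 1 W, so the formula
        for entries of U' A W is reused with the identity in the middle.\<close>
      also have "col W 0 \<bullet>c col W i = (mat_adjoint W * 1\<^sub>m (Suc n) * W) $$ (i, 0)"
      proof -
        have "(mat_adjoint W * 1\<^sub>m (Suc n) * W) $$ (i, 0) = (1\<^sub>m (Suc n) *\<^sub>v col W 0) \<bullet>c col W i"
          using Wc that by (intro index_adjoint_mult_mult) auto
        also have "1\<^sub>m (Suc n) *\<^sub>v col W 0 = col W 0"
          using Wc by (intro one_mult_mat_vec carrier_vecI) auto
        finally show ?thesis by simp
      qed
      also have "mat_adjoint W * 1\<^sub>m (Suc n) * W = 1\<^sub>m (Suc n)"
        using Wc WW by simp
      finally show ?thesis using that by simp
    qed
    have Bt: "B $$ (j, i) = cnj (B $$ (i, j))" if "i < Suc n" "j < Suc n" for i j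
      using that Bc arg_cong[OF Bh, of "\<lambda>M. M $$ (j, i)"] by simp
    \<comment> \<open>The eigenvalue is a diagonal entry of the Hermitian matrix B, hence
      real.\<close>
    have e: "e = complex_of_real (Re e)"
      using Bt[of 0 0] B0[of 0] by (simp add: complex_eq_iff)
    define C where "C = mat n n (\<lambda>(i, j). B $$ (Suc i, Suc j))"
    have Cc: "C \<in> carrier_mat n n" by (simp add: C_def)
    have BC: "B = bordered e C"
    proof (rule eq_matI)
      fix i j assume "i < dim_row (bordered e C)" "j < dim_col (bordered e C)"
      then have "i < Suc n" "j < Suc n" by (auto simp: bordered_def C_def)
      then show "B $$ (i, j) = bordered e C $$ (i, j)"
        using B0 Bt[of j 0] by (auto simp: bordered_def C_def)
    qed (use Bc in \<open>auto simp: bordered_def C_def\<close>)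
    have "mat_adjoint C = C"
      by (intro eq_matI) (auto simp: C_def intro!: Bt[symmetric])
    from Suc.IH[OF Cc this] obtain V f where V: "unitary_mat n V"
      and CV: "C = V * mat_diag n (\<lambda>i. complex_of_real (f i)) * mat_adjoint V" by blast
    have Vc: "V \<in> carrier_mat n n" and VV: "mat_adjoint V * V = 1\<^sub>m n"
      using V by (auto simp: unitary_mat_def)
    \<comment> \<open>The diagonalising unitary V of the smaller block, extended by 1, diagonalises
      B; the unitary for A is then W X.\<close>
    define X where "X = bordered 1 V"
    define D where "D = mat_diag (Suc n) (\<lambda>i. complex_of_real (case_nat (Re e) f i))"
    have Xc: "X \<in> carrier_mat (Suc n) (Suc n)"
      using Vc by (auto simp: X_def bordered_carrier)
    have Dc: "D \<in> carrier_mat (Suc n) (Suc n)" by (simp add: D_def)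
    have "mat_adjoint X * X = 1\<^sub>m (Suc n)"
      using Vc VV by (simp add: X_def bordered_adjoint bordered_mult[of _ n n _ n] bordered_one)
    then have X: "unitary_mat (Suc n) X" by (rule unitary_matI[OF Xc])
    have "D = bordered e (mat_diag n (\<lambda>i. complex_of_real (f i)))"
      using e unfolding D_def bordered_diag
      by (intro arg_cong[of _ _ "mat_diag (Suc n)"]) (auto split: nat.splits)
    then have BX: "B = X * D * mat_adjoint X"
      using Vc unfolding BC CV X_def
      by (simp add: bordered_adjoint bordered_mult[of _ n n _ n])
    have "A = (W * mat_adjoint W) * A * (W * mat_adjoint W)"
      using WW Suc.prems by simp
    also have "\<dots> = W * B * mat_adjoint W"
      using Wc Suc.prems
      by (simp add: B_def assoc_mult_mat[of _ "Suc n" "Suc n" _ "Suc n" _ "Suc n"]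
          mult_carrier_mat[of _ "Suc n" "Suc n" _ "Suc n"])
    also have "\<dots> = (W * X) * D * mat_adjoint (W * X)"
      using Wc Xc Dc
      by (simp add: BX mat_adjoint_mult[of _ "Suc n" "Suc n" _ "Suc n"]
          assoc_mult_mat[of _ "Suc n" "Suc n" _ "Suc n" _ "Suc n"]
          mult_carrier_mat[of _ "Suc n" "Suc n" _ "Suc n"])
    finally show ?case
      using unitary_mat_mult[OF W X] unfolding D_def by blast
  qed
  then show ?thesis using that by blast
qed

section \<open>Functional calculus in a fixed eigenbasis\<close>

lemma unitary_mat_cancel:
  assumes "unitary_mat n U" "X \<in> carrier_mat n m"
  shows "U * (mat_adjoint U * X) = X" "mat_adjoint U * (U * X) = X"
proof -
  have U: "U \<in> carrier_mat n n" "mat_adjoint U * U = 1\<^sub>m n" "U * mat_adjoint U = 1\<^sub>m n"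
    using assms by (auto simp: unitary_mat_def)
  have "U * (mat_adjoint U * X) = (U * mat_adjoint U) * X"
    using U assms by (intro assoc_mult_mat[symmetric]) auto
  then show "U * (mat_adjoint U * X) = X" using U assms by simp
  have "mat_adjoint U * (U * X) = (mat_adjoint U * U) * X"
    using U assms by (intro assoc_mult_mat[symmetric]) auto
  then show "mat_adjoint U * (U * X) = X" using U assms by simp
qed

text \<open>For fixed unitary U, the map from h to this matrix turns pointwise sums, products and
  conjugates into matrix sums, products and adjoints. Identities between a Hermitian matrix, its
  square root, its pseudo-inverse and its kernel projection thus become identities between
  numbers.\<close>

definition spectral_mat :: "nat \<Rightarrow> complex mat \<Rightarrow> (nat \<Rightarrow> complex) \<Rightarrow> complex mat" where
  "spectral_mat n U h = U * mat_diag n h * mat_adjoint U"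

context
  fixes n :: nat and U :: "complex mat"
  assumes U: "unitary_mat n U"
begin

lemma unitary_carrier: "U \<in> carrier_mat n n"
  using U by (auto simp: unitary_mat_def)

lemma spectral_mat_carrier [simp]: "spectral_mat n U h \<in> carrier_mat n n"
  using unitary_carrier by (auto simp: spectral_mat_def)

lemma spectral_mat_adjoint: "mat_adjoint (spectral_mat n U h) = spectral_mat n U (\<lambda>i. cnj (h i))"
  using unitary_carrier
  by (simp add: spectral_mat_def mat_adjoint_mult[of _ n n _ n] mult_carrier_mat[of _ n n _ n]
      assoc_mult_mat[of _ n n _ n _ n])

lemma spectral_mat_mult:
  "spectral_mat n U g * spectral_mat n U h = spectral_mat n U (\<lambda>i. g i * h i)"
proof -
  have "spectral_mat n U g * spectral_mat n U h
      = U * (mat_diag n g * (mat_adjoint U * (U * (mat_diag n h * mat_adjoint U))))"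
    using unitary_carrier
    by (simp add: spectral_mat_def mult_carrier_mat[of _ n n _ n] assoc_mult_mat[of _ n n _ n _ n])
  also have "\<dots> = U * (mat_diag n g * (mat_diag n h * mat_adjoint U))"
    using unitary_carrier
    by (simp add: unitary_mat_cancel[OF U, of _ n] mult_carrier_mat[of _ n n _ n])
  also have "\<dots> = U * (mat_diag n g * mat_diag n h) * mat_adjoint U"
    using unitary_carrier
    by (simp add: mult_carrier_mat[of _ n n _ n] assoc_mult_mat[of _ n n _ n _ n] del: mat_diag_diag)
  finally show ?thesis by (simp add: spectral_mat_def)
qed

lemma spectral_mat_add:
  "spectral_mat n U g + spectral_mat n U h = spectral_mat n U (\<lambda>i. g i + h i)"
proof -
  have "mat_diag n (\<lambda>i. g i + h i) = mat_diag n g + mat_diag n h"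
    by (rule eq_matI) (auto simp: mat_diag_def)
  then show ?thesis
    using unitary_carrier
    by (simp add: spectral_mat_def mult_carrier_mat[of _ n n _ n]
        mult_add_distrib_mat[of _ n n _ n] add_mult_distrib_mat[of _ n n _ _ n])
qed

lemma spectral_mat_one: "spectral_mat n U (\<lambda>i. 1) = 1\<^sub>m n"
  using U by (auto simp: spectral_mat_def unitary_mat_def right_mult_one_mat[of _ n n])

lemma spectral_mat_zero: "spectral_mat n U (\<lambda>i. 0) = 0\<^sub>m n n"
proof -
  have "mat_diag n (\<lambda>i. 0 :: complex) = 0\<^sub>m n n"
    by (rule eq_matI) (auto simp: mat_diag_def)
  then show ?thesis using unitary_carrier by (simp add: spectral_mat_def)
qed

end

subsection \<open>Positive semidefinite square roots\<close>

lemma psd_mat_mult_adjoint: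
  assumes "C \<in> carrier_mat n m"
  shows "psd_mat n (C * mat_adjoint C)"
  unfolding psd_mat_def
proof (intro conjI ballI)
  show "C * mat_adjoint C \<in> carrier_mat n n" using assms by auto
  show "mat_adjoint (C * mat_adjoint C) = C * mat_adjoint C"
    using assms by (simp add: mat_adjoint_mult[of _ n m _ n])
  fix v :: "complex vec" assume v: "v \<in> carrier_vec n"
  have Cv: "mat_adjoint C *\<^sub>v v \<in> carrier_vec m" 
    by (rule mult_mat_vec_carrier[of _ m n]) (use assms v in auto)
  have "(C * mat_adjoint C *\<^sub>v v) \<bullet>c v = (mat_adjoint C *\<^sub>v v) \<bullet>c (mat_adjoint C *\<^sub>v v)"
    using assms v Cv
    by (simp add: assoc_mult_mat_vec[of _ n m _ n] cscalar_prod_adjoint[of _ n m])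
  also have "\<dots> \<ge> 0" by (rule conjugate_square_ge_0_vec)
  finally show "0 \<le> (C * mat_adjoint C *\<^sub>v v) \<bullet>c v" .
qed

text \<open>The eigenvalue \<open>f i\<close> is the value of the quadratic form of R at the i-th
  column of U, hence nonnegative.\<close>

lemma psd_diagonalisation:
  assumes R: "psd_mat n R"
  obtains U f where "unitary_mat n U" "R = spectral_mat n U (\<lambda>i. complex_of_real (f i))"
    "\<And>i. i < n \<Longrightarrow> 0 \<le> f i"
proof -
  have Rc: "R \<in> carrier_mat n n" using R by (auto simp: psd_mat_def)
  have "mat_adjoint R = R" using R by (auto simp: psd_mat_def)
  from hermitian_diagonalisation[OF Rc this] obtain U f where U: "unitary_mat n U"
    and RU: "R = U * mat_diag n (\<lambda>i. complex_of_real (f i)) * mat_adjoint U" by blast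
  have Uc: "U \<in> carrier_mat n n" "mat_adjoint U * U = 1\<^sub>m n" using U by (auto simp: unitary_mat_def)
  have "mat_adjoint U * R * U = mat_diag n (\<lambda>i. complex_of_real (f i))"
    using Uc unfolding RU
    by (simp add: right_mult_one_mat[of _ n n] mult_carrier_mat[of _ n n _ n] assoc_mult_mat[of _ n n _ n _ n]
        unitary_mat_cancel[OF U, of _ n])
  then have *: "complex_of_real (f i) = (R *\<^sub>v col U i) \<bullet>c col U i" if "i < n" for i
    using that index_adjoint_mult_mult[OF Uc(1) Rc Uc(1) that that] by (simp add: mat_diag_def)
  have "0 \<le> f i" if "i < n" for i
  proof -
    have "col U i \<in> carrier_vec n" using Uc that by auto
    then have "0 \<le> complex_of_real (f i)" using R *[OF that] by (auto simp: psd_mat_def)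
    then show ?thesis by (simp add: less_eq_complex_def)
  qed
  then show ?thesis using that U RU unfolding spectral_mat_def by blast
qed

lemma psd_mat_spectral_mat:
  assumes U: "unitary_mat n U" and f: "\<And>i. i < n \<Longrightarrow> 0 \<le> f i"
  shows "psd_mat n (spectral_mat n U (\<lambda>i. complex_of_real (f i)))"
proof -
  let ?C = "spectral_mat n U (\<lambda>i. complex_of_real (sqrt (f i)))"
  \<comment> \<open>The functions themselves need not agree: \<open>f\<close> is nonnegative only
    below n. The diagonal matrices see only these indices.\<close>
  have "mat_diag n (\<lambda>i. complex_of_real (sqrt (f i)) * complex_of_real (sqrt (f i)))
      = mat_diag n (\<lambda>i. complex_of_real (f i))"
    using f by (intro eq_matI) (auto simp: mat_diag_def simp flip: of_real_mult)
  then have "?C * mat_adjoint ?C = spectral_mat n U (\<lambda>i. complex_of_real (f i))"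
    by (simp add: spectral_mat_adjoint[OF U] spectral_mat_mult[OF U]) (simp add: spectral_mat_def)
  then show ?thesis
    using psd_mat_mult_adjoint[OF spectral_mat_carrier[OF U]] by metis
qed

text \<open>Uniqueness of the positive square root, without grouping eigenspaces. With eigenbases U
  of B and V of C, the matrix W = V' U satisfies W_ij f_j^2 = g_i^2 W_ij. So either W_ij = 0 or
  f_j^2 = g_i^2, and then f_j = g_i by nonnegativity. In both cases W_ij f_j = g_i W_ij, which says
  V' B U = V' C U.\<close>

lemma psd_mat_square_inj:
  assumes B: "psd_mat n B" and C: "psd_mat n C" and eq: "B * B = C * C"
  shows "B = C"
proof -
  obtain U f where U: "unitary_mat n U" and BU: "B = spectral_mat n U (\<lambda>i. complex_of_real (f i))"
    and f: "\<And>i. i < n \<Longrightarrow> 0 \<le> f i" using psd_diagonalisation[OF B] by blast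
  obtain V g where V: "unitary_mat n V" and CV: "C = spectral_mat n V (\<lambda>i. complex_of_real (g i))"
    and g: "\<And>i. i < n \<Longrightarrow> 0 \<le> g i" using psd_diagonalisation[OF C] by blast
  have c: "U \<in> carrier_mat n n" "V \<in> carrier_mat n n"
    using U V by (auto simp: unitary_mat_def)
  have UU: "mat_adjoint U * U = 1\<^sub>m n" "U * mat_adjoint U = 1\<^sub>m n"
    using U by (auto simp: unitary_mat_def)
  define W where "W = mat_adjoint V * U"
  have W: "W \<in> carrier_mat n n" using c by (auto simp: W_def)
  have left: "mat_adjoint V * spectral_mat n U h * U = W * mat_diag n h" for h
    using c UU
    by (simp add: spectral_mat_def W_def right_mult_one_mat[of _ n n] mult_carrier_mat[of _ n n _ n]
        assoc_mult_mat[of _ n n _ n _ n])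
  have right: "mat_adjoint V * spectral_mat n V h * U = mat_diag n h * W" for h
    using c
    by (simp add: spectral_mat_def W_def mult_carrier_mat[of _ n n _ n] assoc_mult_mat[of _ n n _ n _ n]
        unitary_mat_cancel[OF V, of _ n])
  have sq: "W * mat_diag n (\<lambda>i. complex_of_real (f i * f i))
      = mat_diag n (\<lambda>i. complex_of_real (g i * g i)) * W"
    using eq left[of "\<lambda>i. complex_of_real (f i * f i)"] right[of "\<lambda>i. complex_of_real (g i * g i)"]
    by (simp add: BU CV spectral_mat_mult[OF U] spectral_mat_mult[OF V])
  have "W $$ (i, j) * complex_of_real (f j) = complex_of_real (g i) * W $$ (i, j)"
    if ij: "i < n" "j < n" for i j
  proof (cases "W $$ (i, j) = 0")
    case False
    have "W $$ (i, j) * complex_of_real (f j * f j) = complex_of_real (g i * g i) * W $$ (i, j)"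
      using arg_cong[OF sq, of "\<lambda>M. M $$ (i, j)"] ij
      by (simp add: mat_diag_mult_left[OF W] mat_diag_mult_right[OF W])
    then have "complex_of_real (f j * f j) = complex_of_real (g i * g i)" using False by simp
    then have "(f j)\<^sup>2 = (g i)\<^sup>2" by (simp only: of_real_eq_iff power2_eq_square)
    then have "f j = g i" using f g ij by (simp add: power2_eq_iff_nonneg)
    then show ?thesis by simp
  qed simp
  then have "W * mat_diag n (\<lambda>i. complex_of_real (f i)) = mat_diag n (\<lambda>i. complex_of_real (g i)) * W"
    by (intro eq_matI) (auto simp: mat_diag_mult_left[OF W] mat_diag_mult_right[OF W])
  then have "mat_adjoint V * B * U = mat_adjoint V * C * U"
    by (simp add: BU CV left right)
  then have "V * (mat_adjoint V * B * U) * mat_adjoint U = V * (mat_adjoint V * C * U) * mat_adjoint U"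
    by simp
  moreover have "V * (mat_adjoint V * X * U) * mat_adjoint U = X" if "X \<in> carrier_mat n n" for X
    using that c UU
    by (simp add: right_mult_one_mat[of _ n n] mult_carrier_mat[of _ n n _ n] assoc_mult_mat[of _ n n _ n _ n]
        unitary_mat_cancel[OF V, of _ n])
  ultimately show ?thesis using B C by (simp add: psd_mat_def)
qed

theorem psd_sqrt:
  assumes R: "psd_mat n R"
  shows "psd_mat n (psd_sqrt R)" "psd_sqrt R * psd_sqrt R = R"
proof -
  have dim: "dim_row R = n" using R by (auto simp: psd_mat_def)
  obtain U f where U: "unitary_mat n U" and RU: "R = spectral_mat n U (\<lambda>i. complex_of_real (f i))"
    and f: "\<And>i. i < n \<Longrightarrow> 0 \<le> f i" using psd_diagonalisation[OF R] by blast
  let ?B = "spectral_mat n U (\<lambda>i. complex_of_real (sqrt (f i)))"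
  have "psd_mat n ?B" using f by (intro psd_mat_spectral_mat[OF U]) auto
  moreover have "mat_diag n (\<lambda>i. complex_of_real (sqrt (f i)) * complex_of_real (sqrt (f i)))
      = mat_diag n (\<lambda>i. complex_of_real (f i))"
    using f by (intro eq_matI) (auto simp: mat_diag_def simp flip: of_real_mult)
  then have "?B * ?B = R"
    by (simp add: RU spectral_mat_mult[OF U]) (simp add: spectral_mat_def)
  ultimately have "\<exists>!B. psd_mat (dim_row R) B \<and> B * B = R"
    unfolding dim using psd_mat_square_inj by blast
  from theI'[OF this] show "psd_mat n (psd_sqrt R)" "psd_sqrt R * psd_sqrt R = R"
    by (simp_all add: psd_sqrt_def dim)
qed

subsection \<open>Factorisation through a right-unitary matrix\<close>

lemma index_mult_adjoint:
  fixes A B :: "complex mat"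
  assumes "A \<in> carrier_mat n m" "B \<in> carrier_mat k m" "i < n" "j < k"
  shows "(A * mat_adjoint B) $$ (i, j) = (\<Sum>l<m. A $$ (i, l) * cnj (B $$ (j, l)))"
  using assms
  by (subst index_mult_sum[of _ n m _ k]) auto

text \<open>The diagonal entries of X X' are the squared norms of the rows of X.\<close>

lemma mult_adjoint_eq_0:
  fixes X :: "complex mat"
  assumes X: "X \<in> carrier_mat n m" and XX: "X * mat_adjoint X = 0\<^sub>m n n"
  shows "X = 0\<^sub>m n m"
proof (rule eq_matI)
  fix i j assume "i < dim_row (0\<^sub>m n m :: complex mat)" "j < dim_col (0\<^sub>m n m :: complex mat)"
  then have ij: "i < n" "j < m" by auto
  have "complex_of_real (\<Sum>l<m. (cmod (X $$ (i, l)))\<^sup>2) = (X * mat_adjoint X) $$ (i, i)"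
    using ij by (simp add: index_mult_adjoint[OF X X] complex_norm_square del: of_real_power)
  also have "\<dots> = complex_of_real 0" using ij by (simp add: XX)
  finally have "(\<Sum>l<m. (cmod (X $$ (i, l)))\<^sup>2) = 0" by (simp only: of_real_eq_iff)
  then show "X $$ (i, j) = 0\<^sub>m n m $$ (i, j)"
    using ij by (auto simp: sum_nonneg_eq_0_iff)
qed (use X in auto)

lemma sum_lessThan_add:
  fixes f :: "nat \<Rightarrow> 'a::comm_monoid_add"
  shows "sum f {..<m + n} = sum f {..<m} + (\<Sum>i<n. f (m + i))"
  by (induction n) (auto simp: add.assoc)

text \<open>\<open>S * T\<close> is described by its entries, which expresses the zero padding
  without block matrices. The n appended columns also ensure that T has at least n columns, whatever
  m is.\<close>

lemma right_unitary_factor: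
  fixes S M :: "complex mat"
  assumes S: "S \<in> carrier_mat n n" "mat_adjoint S = S" and M: "M \<in> carrier_mat n m"
    and SM: "S * S = M * mat_adjoint M"
  obtains T where "T \<in> carrier_mat n (m + n)" "right_unitary T"
    "\<And>i j. i < n \<Longrightarrow> j < m + n \<Longrightarrow> (S * T) $$ (i, j) = (if j < m then M $$ (i, j) else 0)"
proof -
  obtain U f where U: "unitary_mat n U"
    and "S = U * mat_diag n (\<lambda>i. complex_of_real (f i)) * mat_adjoint U"
    using hermitian_diagonalisation[OF S] by blast
  then have SU: "S = spectral_mat n U (\<lambda>i. complex_of_real (f i))"
    by (simp add: spectral_mat_def)
  txt \<open>the pseudo-inverse of \<open>S\<close> and the orthogonal projection onto its kernel\<close>
  define G where "G = spectral_mat n U (\<lambda>i. complex_of_real (inverse (f i)))"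
  define P where "P = spectral_mat n U (\<lambda>i. if f i = 0 then 1 else 0)"
  have c: "G \<in> carrier_mat n n" "P \<in> carrier_mat n n"
    using U by (simp_all add: G_def P_def)
  have GM: "G * M \<in> carrier_mat n m" using c M by auto
  have adj: "mat_adjoint G = G" "mat_adjoint P = P"
    by (simp_all add: G_def P_def spectral_mat_adjoint[OF U] if_distrib cong: if_cong)
  have spectral_cong: "spectral_mat n U g = spectral_mat n U h" if "\<And>i. g i = h i" for g h
    using that by presburger
  have SP: "S * P = 0\<^sub>m n n"
    unfolding SU P_def spectral_mat_mult[OF U] spectral_mat_zero[OF U, symmetric]
    by (rule spectral_cong) auto
  \<comment> \<open>Since \<open>inverse 0 = 0\<close>, the product of \<open>f i\<close> and its
    inverse is 1 off the kernel and 0 on it; P contributes 1 exactly on the kernel.\<close>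
  have SGP: "S * G + P = 1\<^sub>m n"
    unfolding SU P_def G_def spectral_mat_mult[OF U] spectral_mat_add[OF U]
      spectral_mat_one[OF U, symmetric]
    by (rule spectral_cong) auto
  \<comment> \<open>This becomes T T' = 1 once S S is replaced by M M'.\<close>
  have one: "G * (S * S) * G + P * P = 1\<^sub>m n"
    unfolding SU P_def G_def spectral_mat_mult[OF U] spectral_mat_add[OF U]
      spectral_mat_one[OF U, symmetric]
    by (rule spectral_cong) (auto simp: field_simps)
  \<comment> \<open>The columns of M lie in the range of S: replacing M M' by S S shows that P M has
    vanishing Gram matrix of rows.\<close>
  have "(P * M) * mat_adjoint (P * M) = P * (M * mat_adjoint M) * P"
    using c M by (simp add: mat_adjoint_mult[of _ n n _ m] adj assoc_mult_mat[of _ n n _ n _ n]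
        assoc_mult_mat[of _ n n _ m _ n] assoc_mult_mat[of _ n m _ n _ n]
        mult_carrier_mat[of _ n n _ m] mult_carrier_mat[of _ m n _ n] mult_carrier_mat[of _ n m _ n])
  also have "\<dots> = P * S * (S * P)"
    using c S by (simp add: SM[symmetric] assoc_mult_mat[of _ n n _ n _ n] mult_carrier_mat[of _ n n _ n])
  also have "\<dots> = 0\<^sub>m n n" using c S by (simp add: SP mult_carrier_mat[of _ n n _ n])
  finally have PM: "P * M = 0\<^sub>m n m"
    by (rule mult_adjoint_eq_0[OF mult_carrier_mat[OF c(2) M]])
  have "M = (S * G + P) * M" unfolding SGP by (rule left_mult_one_mat[OF M, symmetric])
  also have "\<dots> = S * G * M + P * M"
    using c S M by (intro add_mult_distrib_mat[of _ n n _ _ m]) auto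
  also have "\<dots> = S * (G * M)"
    using c S M by (simp add: PM assoc_mult_mat[of _ n n _ n _ m] mult_carrier_mat[of _ n n _ m])
  finally have SGM: "S * (G * M) = M" by simp
  define T where "T = mat n (m + n) (\<lambda>(i, j). if j < m then (G * M) $$ (i, j) else P $$ (i, j - m))"
  have T: "T \<in> carrier_mat n (m + n)" by (simp add: T_def)
  have "T * mat_adjoint T = 1\<^sub>m n"
  proof (rule eq_matI)
    fix i j assume "i < dim_row (1\<^sub>m n :: complex mat)" "j < dim_col (1\<^sub>m n :: complex mat)"
    then have ij: "i < n" "j < n" by auto
    have "(T * mat_adjoint T) $$ (i, j) = (\<Sum>l<m. (G * M) $$ (i, l) * cnj ((G * M) $$ (j, l)))
        + (\<Sum>l<n. P $$ (i, l) * cnj (P $$ (j, l)))"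
      using ij by (simp add: index_mult_adjoint[OF T T] sum_lessThan_add)
        (simp add: T_def del: index_mult_mat(1))
    also have "\<dots> = ((G * M) * mat_adjoint (G * M) + P * mat_adjoint P) $$ (i, j)"
      using ij c GM by (simp add: index_mult_adjoint[OF GM GM] index_mult_adjoint[OF c(2) c(2)]
          del: index_mult_mat(1))
    also have "(G * M) * mat_adjoint (G * M) = G * (M * mat_adjoint M) * G"
      using c M by (simp add: mat_adjoint_mult[of _ n n _ m] adj assoc_mult_mat[of _ n n _ n _ n]
          assoc_mult_mat[of _ n n _ m _ n] assoc_mult_mat[of _ n m _ n _ n]
          mult_carrier_mat[of _ n n _ m] mult_carrier_mat[of _ m n _ n] mult_carrier_mat[of _ n m _ n])
    finally show "(T * mat_adjoint T) $$ (i, j) = 1\<^sub>m n $$ (i, j)"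
      by (simp add: adj SM[symmetric] one)
  qed (use T in auto)
  then have "right_unitary T" using T by (auto simp: right_unitary_def)
  moreover have "(S * T) $$ (i, j) = (if j < m then M $$ (i, j) else 0)"
    if ij: "i < n" "j < m + n" for i j
  proof (cases "j < m")
    case True
    have "(S * T) $$ (i, j) = (S * (G * M)) $$ (i, j)"
      using ij True by (simp add: index_mult_sum[OF S(1) T] index_mult_sum[OF S(1) GM] del: index_mult_mat(1))
        (simp add: T_def del: index_mult_mat(1))
    then show ?thesis using True SGM by simp
  next
    case False
    then have "(S * T) $$ (i, j) = (S * P) $$ (i, j - m)"
      using ij by (simp add: index_mult_sum[OF S(1) T] index_mult_sum[OF S(1) c(2)] del: index_mult_mat(1))
        (simp add: T_def del: index_mult_mat(1))
    then show ?thesis using False SP ij by simp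
  qed
  ultimately show ?thesis using that T by blast
qed

subsection \<open>Matrices with columns in a tensor product\<close>

lemma pair_index_less: "i < m \<Longrightarrow> a < n \<Longrightarrow> i * n + a < m * (n :: nat)"
  using mult_le_mono1[of "Suc i" m n] by simp

lemma sum_pair_index:
  fixes f :: "nat \<Rightarrow> 'a::comm_monoid_add"
  shows "(\<Sum>r<m * n. f r) = (\<Sum>i<m. \<Sum>a<n. f (i * n + a))"
  by (induction m) (simp_all add: add.commute[of n] sum_lessThan_add)

lemma mat_unit_carrier [simp]: "mat_unit d k l \<in> carrier_mat d d"
  by (simp add: mat_unit_def)

lemma index_kron_one:
  assumes "B \<in> carrier_mat d d" "i < d" "a < d" "j < d" "b < d"
  shows "kron B (1\<^sub>m d) $$ (i * d + a, j * d + b) = (if a = b then B $$ (i, j) else 0)"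
  using assms by (simp add: kron_def pair_index_less)

text \<open>The first tensor factor, on which \<Phi> acts, becomes the row index. With this choice
  \<open>kron B 1\<close> acts on the column as left multiplication of V by B, and V V' is the
  partial trace of the column's rank-one matrix over the second factor.\<close>

definition unvec_col :: "nat \<Rightarrow> complex mat \<Rightarrow> nat \<Rightarrow> complex mat" where
  "unvec_col d M k = mat d d (\<lambda>(i, a). M $$ (i * d + a, k))"

lemma unvec_col_carrier [simp]: "unvec_col d M k \<in> carrier_mat d d"
  by (simp add: unvec_col_def)

lemma dim_unvec_col [simp]: "dim_row (unvec_col d M k) = d" "dim_col (unvec_col d M k) = d"
  by (simp_all add: unvec_col_def)

lemma index_unvec_col [simp]: "i < d \<Longrightarrow> a < d \<Longrightarrow> unvec_col d M k $$ (i, a) = M $$ (i * d + a, k)"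
  by (simp add: unvec_col_def)

lemma index_conjugation:
  fixes V X :: "complex mat"
  assumes V: "V \<in> carrier_mat d d" and X: "X \<in> carrier_mat d d" and ij: "i < d" "j < d"
  shows "(V * X * mat_adjoint V) $$ (i, j)
    = (\<Sum>a<d. \<Sum>b<d. X $$ (a, b) * (V $$ (i, a) * cnj (V $$ (j, b))))"
proof -
  have "(V * X * mat_adjoint V) $$ (i, j) = (\<Sum>b<d. (V * X) $$ (i, b) * cnj (V $$ (j, b)))"
    using V X ij by (intro index_mult_adjoint[of _ d]) auto
  also have "\<dots> = (\<Sum>b<d. \<Sum>a<d. X $$ (a, b) * (V $$ (i, a) * cnj (V $$ (j, b))))"
    using V X ij
    by (intro sum.cong)
      (auto simp: index_mult_sum[OF V X] sum_distrib_left mult_ac simp del: index_mult_mat(1))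
  also have "\<dots> = (\<Sum>a<d. \<Sum>b<d. X $$ (a, b) * (V $$ (i, a) * cnj (V $$ (j, b))))"
    by (rule sum.swap)
  finally show ?thesis .
qed

text \<open>The right-hand side is Tr(B V V') for V the reshaped k-th column: the left-hand side is
  the inner product of vec (B V) with vec V.\<close>

lemma diag_conjugated_kron:
  assumes M: "M \<in> carrier_mat (d * d) K" and B: "B \<in> carrier_mat d d" and k: "k < K"
  shows "(mat_adjoint M * kron B (1\<^sub>m d) * M) $$ (k, k)
    = (\<Sum>j<d. \<Sum>i<d. B $$ (i, j) * (unvec_col d M k * mat_adjoint (unvec_col d M k)) $$ (j, i))"
proof -
  let ?V = "unvec_col d M k"
  have kr: "kron B (1\<^sub>m d) \<in> carrier_mat (d * d) (d * d)" using B by (simp add: kron_def)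
  have Mk: "mat_adjoint M * kron B (1\<^sub>m d) \<in> carrier_mat K (d * d)"
    by (rule mult_carrier_mat[OF mat_adjoint_carrier[OF M] kr])
  have "(mat_adjoint M * kron B (1\<^sub>m d)) $$ (k, j * d + b)
      = (\<Sum>i<d. cnj (?V $$ (i, b)) * B $$ (i, j))" if "j < d" "b < d" for j b
  proof -
    have "(mat_adjoint M * kron B (1\<^sub>m d)) $$ (k, j * d + b)
        = (\<Sum>r<d * d. mat_adjoint M $$ (k, r) * kron B (1\<^sub>m d) $$ (r, j * d + b))"
      using M k that by (intro index_mult_sum[OF _ kr]) (auto simp: pair_index_less)
    also have "\<dots> = (\<Sum>i<d. \<Sum>a<d. if a = b then cnj (?V $$ (i, a)) * B $$ (i, j) else 0)"
      unfolding sum_pair_index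
      using M k that B by (intro sum.cong) (auto simp: index_kron_one pair_index_less)
    finally show ?thesis using that by simp
  qed
  then have "(mat_adjoint M * kron B (1\<^sub>m d) * M) $$ (k, k)
      = (\<Sum>j<d. \<Sum>b<d. \<Sum>i<d. cnj (?V $$ (i, b)) * B $$ (i, j) * ?V $$ (j, b))"
    using k by (simp add: index_mult_sum[OF Mk M] sum_pair_index sum_distrib_right
        del: index_mult_mat(1))
  also have "\<dots> = (\<Sum>j<d. \<Sum>i<d. B $$ (i, j) * (\<Sum>b<d. ?V $$ (j, b) * cnj (?V $$ (i, b))))"
  proof (rule sum.cong[OF refl])
    fix j
    show "(\<Sum>b<d. \<Sum>i<d. cnj (?V $$ (i, b)) * B $$ (i, j) * ?V $$ (j, b))
        = (\<Sum>i<d. B $$ (i, j) * (\<Sum>b<d. ?V $$ (j, b) * cnj (?V $$ (i, b))))"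
      by (subst sum.swap) (simp add: sum_distrib_left mult_ac del: index_unvec_col)
  qed
  finally show ?thesis
    by (simp add: index_mult_adjoint[OF unvec_col_carrier unvec_col_carrier]
        del: index_mult_mat(1) index_unvec_col)
qed

subsection \<open>Orthogonality to the Gell-Mann matrices\<close>

lemma sum_single_entry:
  fixes f :: "nat \<Rightarrow> nat \<Rightarrow> complex"
  assumes "k < d" "l < d"
  shows "(\<Sum>j<d. \<Sum>i<d. (if i = k \<and> j = l then x else 0) * f j i) = x * f l k"
proof -
  have "(\<Sum>j<d. \<Sum>i<d. (if i = k \<and> j = l then x else 0) * f j i)
      = (\<Sum>j<d. if j = l then (\<Sum>i<d. if i = k then x * f j i else 0) else 0)"
    by (intro sum.cong refl) (auto simp: if_distrib[of "\<lambda>y. y * z" for z] cong: if_cong)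
  then show ?thesis using assms by simp
qed

lemma sum_gm_diag_weights:
  fixes g :: "nat \<Rightarrow> complex"
  assumes "k < d"
  shows "(\<Sum>r<d. (if r < k then 1 else if r = k then - of_nat k else 0) * g r)
    = (\<Sum>r<k. g r) - of_nat k * g k"
proof -
  obtain e where d: "d = Suc k + e" using assms less_iff_Suc_add by auto
  show ?thesis unfolding d sum_lessThan_add by simp
qed

lemma gell_mann_carrier: "B \<in> gell_mann d \<Longrightarrow> B \<in> carrier_mat d d"
  by (auto simp: gell_mann_def gm_sym_def gm_asym_def gm_diag_def intro!: smult_carrier_mat minus_carrier_mat)

lemma gell_mann_traceless:
  assumes "B \<in> gell_mann d"
  shows "(\<Sum>i<d. B $$ (i, i)) = 0"
proof -
  consider k l where "B = gm_sym d k l" "k < l" "l < d" | k l where "B = gm_asym d k l" "k < l" "l < d"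
    | k where "B = gm_diag d k" "1 \<le> k" "k \<le> d - 1"
    using assms unfolding gell_mann_def by blast
  then show ?thesis
  proof cases
    case 1
    then show ?thesis by (auto simp: gm_sym_def mat_unit_def)
  next
    case 2
    then show ?thesis by (auto simp: gm_asym_def mat_unit_def)
  next
    case 3
    then have "k < d" by simp
    \<comment> \<open>With constant weight function 1, the diagonal entries sum to k - k = 0 up to
      the scalar factor.\<close>
    from sum_gm_diag_weights[OF this, of "\<lambda>_. 1"] show ?thesis
      by (simp add: 3 gm_diag_def mat_diag_def flip: sum_distrib_left)
  qed
qed

text \<open>The hypothesis says Tr(B W) = 0. The symmetric and antisymmetric matrices give W_lk +
  W_kl = 0 and W_lk - W_kl = 0, so both entries vanish. The k-th diagonal matrix says that W_kk is
  the average of the k preceding diagonal entries, so strong induction makes all of them equal to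
  W_00.\<close>

lemma scalar_if_orthogonal_to_gell_mann:
  fixes W :: "complex mat"
  assumes orth: "\<And>B. B \<in> gell_mann d \<Longrightarrow> (\<Sum>j<d. \<Sum>i<d. B $$ (i, j) * W $$ (j, i)) = 0"
    and rs: "r < d" "s < d"
  shows "W $$ (r, s) = (if r = s then W $$ (0, 0) else 0)"
proof -
  have off: "W $$ (l, k) = 0 \<and> W $$ (k, l) = 0" if kl: "k < l" "l < d" for k l
  proof -
    have k: "k < d" using kl by simp
    have mem: "gm_sym d k l \<in> gell_mann d" "gm_asym d k l \<in> gell_mann d"
      using kl unfolding gell_mann_def by blast+
    have "(\<Sum>j<d. \<Sum>i<d. gm_sym d k l $$ (i, j) * W $$ (j, i))
        = (\<Sum>j<d. \<Sum>i<d. (if i = k \<and> j = l then 1 else 0) * W $$ (j, i)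
          + (if i = l \<and> j = k then 1 else 0) * W $$ (j, i))"
      using kl by (intro sum.cong refl) (simp add: gm_sym_def mat_unit_def)
    also have "\<dots> = W $$ (l, k) + W $$ (k, l)"
      using sum_single_entry[of k d l 1 "\<lambda>j i. W $$ (j, i)"] k kl
        sum_single_entry[of l d k 1 "\<lambda>j i. W $$ (j, i)"]
      by (simp only: sum.distrib) simp
    finally have sym: "W $$ (l, k) + W $$ (k, l) = 0"
      using orth[of "gm_sym d k l"] mem by simp
    have "(\<Sum>j<d. \<Sum>i<d. gm_asym d k l $$ (i, j) * W $$ (j, i))
        = (\<Sum>j<d. \<Sum>i<d. (if i = k \<and> j = l then \<i> else 0) * W $$ (j, i)
          + (if i = l \<and> j = k then - \<i> else 0) * W $$ (j, i))"
      using kl by (intro sum.cong refl) (simp add: gm_asym_def mat_unit_def)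
    also have "\<dots> = \<i> * W $$ (l, k) - \<i> * W $$ (k, l)"
      using sum_single_entry[of k d l \<i> "\<lambda>j i. W $$ (j, i)"] k kl
        sum_single_entry[of l d k "- \<i>" "\<lambda>j i. W $$ (j, i)"]
      by (simp only: sum.distrib) simp
    finally have "\<i> * W $$ (l, k) - \<i> * W $$ (k, l) = 0"
      using orth[of "gm_asym d k l"] mem by simp
    then have "W $$ (l, k) = W $$ (k, l)" by simp
    then show ?thesis using sym by simp
  qed
  have diag: "W $$ (k, k) = W $$ (0, 0)" if "k < d" for k
    using that
  proof (induction k rule: less_induct)
    case (less k)
    show ?case
    proof (cases "k = 0")
      case False
      have "1 \<le> k \<and> k \<le> d - 1" using False less.prems by simp
      then have mem: "gm_diag d k \<in> gell_mann d" unfolding gell_mann_def by blast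
      define c where "c = complex_of_real (sqrt (2 / (real k ^ 2 + real k)))"
      have "real k ^ 2 + real k > 0" using False by (simp add: add_pos_pos)
      then have c: "c \<noteq> 0" by (simp add: c_def)
      have "(\<Sum>j<d. \<Sum>i<d. gm_diag d k $$ (i, j) * W $$ (j, i))
          = (\<Sum>j<d. \<Sum>i<d. if i = j
              then c * ((if j < k then 1 else if j = k then - of_nat k else 0) * W $$ (j, j)) else 0)"
        by (intro sum.cong refl) (auto simp: gm_diag_def mat_diag_def c_def)
      also have "\<dots> = c * (\<Sum>j<d. (if j < k then 1 else if j = k then - of_nat k else 0) * W $$ (j, j))"
        by (simp add: sum_distrib_left)
      also have "\<dots> = c * ((\<Sum>j<k. W $$ (j, j)) - of_nat k * W $$ (k, k))"
        by (simp only: sum_gm_diag_weights[OF less.prems])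
      also have "(\<Sum>j<k. W $$ (j, j)) = (\<Sum>j<k. W $$ (0, 0))"
      proof (rule sum.cong[OF refl])
        fix j assume "j \<in> {..<k}"
        then show "W $$ (j, j) = W $$ (0, 0)" using less.prems by (intro less.IH) auto
      qed
      finally have "c * (of_nat k * W $$ (0, 0) - of_nat k * W $$ (k, k)) = 0"
        using orth[OF mem] by simp
      then show ?thesis using c False by simp
    qed simp
  qed
  consider "r < s" | "s < r" | "r = s" by linarith
  then show ?thesis
  proof cases
    case 3
    then show ?thesis using diag[OF rs(1)] by simp
  qed (use off rs in auto)
qed

subsection \<open>Choi matrices and Kraus decompositions\<close>

lemma outer_prod_psd: "psd_mat (dim_vec v) (outer_prod v)"
proof -
  let ?C = "mat (dim_vec v) 1 (\<lambda>(i, j). v $ i)"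
  have "outer_prod v = ?C * mat_adjoint ?C"
    by (rule eq_matI) (auto simp: outer_prod_def index_mult_adjoint[of _ "dim_vec v" 1 _ "dim_vec v"]
        simp del: index_mult_mat(1))
  then show ?thesis using psd_mat_mult_adjoint[of ?C "dim_vec v" 1] by simp
qed

text \<open>Complete positivity enters here, through the ampliation with n = d; it provides the
  square root of the Choi matrix.\<close>

lemma choi_psd:
  assumes "completely_positive d \<Phi>"
  shows "psd_mat (d * d) (choi d \<Phi>)"
  using assms outer_prod_psd[of "max_entangled d"]
  by (simp add: completely_positive_def choi_def max_entangled_def)

context
  fixes d :: nat and \<Phi> :: "complex mat \<Rightarrow> complex mat"
  assumes lin: "linear_mat_map d \<Phi>"
begin

text \<open>Linearity is stated for two summands, so the expansion of X in matrix units is built up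
  by induction on the set S of positions whose entries are kept.\<close>

lemma index_linear_mat_map:
  assumes X: "X \<in> carrier_mat d d" and ij: "i < d" "j < d"
  shows "\<Phi> X $$ (i, j) = (\<Sum>a<d. \<Sum>b<d. X $$ (a, b) * \<Phi> (mat_unit d a b) $$ (i, j))"
proof -
  have "\<Phi> (mat d d (\<lambda>p. if p \<in> S then X $$ p else 0)) $$ (i, j)
      = (\<Sum>(a, b)\<in>S. X $$ (a, b) * \<Phi> (mat_unit d a b) $$ (i, j))"
    if "finite S" "S \<subseteq> {..<d} \<times> {..<d}" for S
    using that
  proof (induction S rule: finite_induct)
    case empty
    \<comment> \<open>That \<Phi> maps 0 to 0 is obtained from homogeneity with scalar 0.\<close>
    have "\<Phi> (0 \<cdot>\<^sub>m 0\<^sub>m d d) = 0 \<cdot>\<^sub>m \<Phi> (0\<^sub>m d d)"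
      using lin zero_carrier_mat[of d d] unfolding linear_mat_map_def by blast
    moreover have "\<Phi> (0\<^sub>m d d) \<in> carrier_mat d d"
      using lin zero_carrier_mat[of d d] unfolding linear_mat_map_def by blast
    ultimately have "\<Phi> (0 \<cdot>\<^sub>m 0\<^sub>m d d) $$ (i, j) = 0"
      using ij by (simp only: index_smult_mat carrier_matD mult_zero_left)
    moreover have "0 \<cdot>\<^sub>m 0\<^sub>m d d = mat d d (\<lambda>p. 0 :: complex)"
      by (rule eq_matI) auto
    ultimately show ?case by simp
  next
    case (insert p S)
    obtain a b where p: "p = (a, b)" by (cases p)
    let ?R = "mat d d (\<lambda>p. if p \<in> S then X $$ p else 0)"
    have "mat d d (\<lambda>q. if q \<in> insert p S then X $$ q else 0) = ?R + X $$ (a, b) \<cdot>\<^sub>m mat_unit d a b"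
      using insert p by (intro eq_matI) (auto simp: mat_unit_def)
    moreover have "\<Phi> (?R + X $$ (a, b) \<cdot>\<^sub>m mat_unit d a b)
        = \<Phi> ?R + X $$ (a, b) \<cdot>\<^sub>m \<Phi> (mat_unit d a b)"
      using lin by (simp add: linear_mat_map_def)
    moreover have "\<Phi> ?R \<in> carrier_mat d d" "\<Phi> (mat_unit d a b) \<in> carrier_mat d d"
      using lin by (simp_all add: linear_mat_map_def)
    ultimately show ?case using insert p ij by (simp add: add.commute)
  qed
  from this[of "{..<d} \<times> {..<d}"]
  have "\<Phi> (mat d d (\<lambda>p. if p \<in> {..<d} \<times> {..<d} then X $$ p else 0)) $$ (i, j)
      = (\<Sum>a<d. \<Sum>b<d. X $$ (a, b) * \<Phi> (mat_unit d a b) $$ (i, j))"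
    by (simp add: sum.cartesian_product)
  moreover have "mat d d (\<lambda>p. if p \<in> {..<d} \<times> {..<d} then X $$ p else 0) = X"
    using X by (intro eq_matI) auto
  ultimately show ?thesis by simp
qed

text \<open>Equivalently, the Choi matrix is (1/d) times the sum of \<Phi>(E_ab) (x) E_ab; the 1/d
  is the product of the two factors 1/sqrt d in \<open>max_entangled\<close>.\<close>

lemma index_choi:
  assumes "i < d" "a < d" "j < d" "b < d"
  shows "choi d \<Phi> $$ (i * d + a, j * d + b) = \<Phi> (mat_unit d a b) $$ (i, j) / of_nat d"
proof -
  have s: "complex_of_real (sqrt (real d)) * complex_of_real (sqrt (real d)) = of_nat d"
    by (simp flip: of_real_mult)
  have "mat d d (\<lambda>(k, l). outer_prod (max_entangled d) $$ (k * d + a, l * d + b))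
      = (1 / of_nat d) \<cdot>\<^sub>m mat_unit d a b"
    using assms by (intro eq_matI)
      (auto simp: outer_prod_def max_entangled_def mat_unit_def pair_index_less s)
  moreover have "\<Phi> ((1 / of_nat d) \<cdot>\<^sub>m mat_unit d a b) = (1 / of_nat d) \<cdot>\<^sub>m \<Phi> (mat_unit d a b)"
    "\<Phi> (mat_unit d a b) \<in> carrier_mat d d"
    using lin by (simp_all add: linear_mat_map_def)
  ultimately show ?thesis
    using assms by (simp add: choi_def tensor_id_def pair_index_less)
qed

text \<open>Entry (ia, jb) of M M' is the sum over k of V_k(i,a) times the conjugate of V_k(j,b),
  which is the Kraus formula on the matrix unit E_ab; linearity does the rest. The factor d undoes
  the normalisation of the Choi matrix.\<close>

lemma kraus_if_choi_factor:
  assumes M: "M \<in> carrier_mat (d * d) K" and \<rho>: "choi d \<Phi> = M * mat_adjoint M"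
    and X: "X \<in> carrier_mat d d" and ij: "i < d" "j < d"
  shows "\<Phi> X $$ (i, j)
    = (\<Sum>k<K. of_nat d * (unvec_col d M k * X * mat_adjoint (unvec_col d M k)) $$ (i, j))"
proof -
  have unit: "\<Phi> (mat_unit d a b) $$ (i, j)
      = (\<Sum>k<K. of_nat d * (unvec_col d M k $$ (i, a) * cnj (unvec_col d M k $$ (j, b))))"
    if "a < d" "b < d" for a b
  proof -
    have "\<Phi> (mat_unit d a b) $$ (i, j) = of_nat d * (M * mat_adjoint M) $$ (i * d + a, j * d + b)"
      using index_choi[of i a j b] ij that by (simp add: \<rho>)
    then show ?thesis
      using that ij by (simp add: index_mult_adjoint[OF M M] pair_index_less sum_distrib_left
          del: index_mult_mat(1))
  qed
  have "\<Phi> X $$ (i, j) = (\<Sum>a<d. \<Sum>b<d. X $$ (a, b) * (\<Sum>k<K. of_nat d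
      * (unvec_col d M k $$ (i, a) * cnj (unvec_col d M k $$ (j, b)))))"
    using index_linear_mat_map[OF X ij] unit by simp
  also have "\<dots> = (\<Sum>k<K. \<Sum>a<d. \<Sum>b<d. X $$ (a, b) * (of_nat d
      * (unvec_col d M k $$ (i, a) * cnj (unvec_col d M k $$ (j, b)))))"
    unfolding sum_distrib_left
    by (subst sum.swap[of _ "{..<K}" "{..<d}"], subst sum.swap[of _ "{..<K}" "{..<d}"]) (rule refl)
  also have "\<dots> = (\<Sum>k<K. of_nat d * (unvec_col d M k * X * mat_adjoint (unvec_col d M k)) $$ (i, j))"
    by (simp add: index_conjugation[OF unvec_col_carrier X ij] sum_distrib_left mult_ac
        del: index_mult_mat(1) index_unvec_col)
  finally show ?thesis .
qed

text \<open>If V_k V_k' = c_k 1, then V_k is sqrt(c_k) times a unitary U_k, and the Kraus term d V_k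
  X V_k' is U_k X U_k' with weight d c_k.\<close>

lemma random_unitary_if_choi_factor:
  assumes d: "0 < d" and un: "unital d \<Phi>"
    and M: "M \<in> carrier_mat (d * d) K" and \<rho>: "choi d \<Phi> = M * mat_adjoint M"
    and scalar: "\<And>k r s. k < K \<Longrightarrow> r < d \<Longrightarrow> s < d \<Longrightarrow>
      (unvec_col d M k * mat_adjoint (unvec_col d M k)) $$ (r, s)
        = (if r = s then (unvec_col d M k * mat_adjoint (unvec_col d M k)) $$ (0, 0) else 0)"
  shows "random_unitary d \<Phi>"
proof -
  define V where "V = unvec_col d M"
  have V: "V k \<in> carrier_mat d d" for k by (simp add: V_def)
  \<comment> \<open>The scalar is the (0, 0) entry of V_k V_k', written as the squared norm of row 0
    so that it is visibly real and nonnegative.\<close>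
  define c where "c k = (\<Sum>a<d. (cmod (V k $$ (0, a)))\<^sup>2)" for k
  have c0: "0 \<le> c k" for k by (simp add: c_def sum_nonneg)
  have "(V k * mat_adjoint (V k)) $$ (0, 0) = complex_of_real (c k)" for k
    using d by (simp add: index_mult_adjoint[OF V V] c_def complex_norm_square
        del: index_mult_mat(1) of_real_power)
  then have VV: "V k * mat_adjoint (V k) = complex_of_real (c k) \<cdot>\<^sub>m 1\<^sub>m d" if "k < K" for k
    using scalar[OF that] V[of k] by (intro eq_matI) (auto simp: V_def simp del: index_mult_mat(1))
  \<comment> \<open>If c_k = 0 then V_k = 0, so any unitary may stand in: its weight is 0.\<close>
  define U where "U k = (if c k = 0 then 1\<^sub>m d else complex_of_real (1 / sqrt (c k)) \<cdot>\<^sub>m V k)" for k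
  have U: "U k \<in> carrier_mat d d" for k using V by (simp add: U_def)
  have unitary: "unitary_mat d (U k)" if "k < K" for k
  proof (cases "c k = 0")
    case True
    then show ?thesis by (simp add: U_def unitary_mat_def)
  next
    case False
    have "U k * mat_adjoint (U k) = 1\<^sub>m d"
    proof (rule eq_matI)
      fix i j assume "i < dim_row (1\<^sub>m d :: complex mat)" "j < dim_col (1\<^sub>m d :: complex mat)"
      then have ij: "i < d" "j < d" by auto
      have "(U k * mat_adjoint (U k)) $$ (i, j)
          = (\<Sum>l<d. (V k $$ (i, l) * cnj (V k $$ (j, l))) / complex_of_real (c k))"
        using ij False c0[of k] V[of k]
        by (simp add: index_mult_adjoint[OF U U] del: index_mult_mat(1))
          (simp add: U_def flip: of_real_mult)
      also have "\<dots> = (V k * mat_adjoint (V k)) $$ (i, j) / complex_of_real (c k)"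
        using ij by (simp add: index_mult_adjoint[OF V V] sum_divide_distrib del: index_mult_mat(1))
      finally show "(U k * mat_adjoint (U k)) $$ (i, j) = 1\<^sub>m d $$ (i, j)"
        using False ij by (simp add: VV[OF that])
    qed (use U in auto)
    then show ?thesis
      using U mat_mult_left_right_inverse[OF U mat_adjoint_carrier[OF U]]
      by (auto simp: unitary_mat_def)
  qed
  have conj: "complex_of_real (real d * c k) * (U k * X * mat_adjoint (U k)) $$ (i, j)
      = of_nat d * (V k * X * mat_adjoint (V k)) $$ (i, j)"
    if k: "k < K" and X: "X \<in> carrier_mat d d" and ij: "i < d" "j < d" for k X i j
  proof (cases "c k = 0")
    case True
    have "V k * mat_adjoint (V k) = 0\<^sub>m d d"
      using VV[OF k] True by (auto intro!: eq_matI)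
    then have "V k = 0\<^sub>m d d" by (rule mult_adjoint_eq_0[OF V])
    then have "(V k * X * mat_adjoint (V k)) $$ (i, j) = 0"
      unfolding index_conjugation[OF V X ij] using ij by simp
    then show ?thesis using True by simp
  next
    case False
    have scaled: "complex_of_real (c k) * (U k $$ (i, a) * cnj (U k $$ (j, b)))
        = V k $$ (i, a) * cnj (V k $$ (j, b))" if "a < d" "b < d" for a b
      using that ij False c0[of k] V[of k] by (simp add: U_def flip: of_real_mult)
    have summand: "X $$ (a, b) * (U k $$ (i, a) * cnj (U k $$ (j, b))) * complex_of_real (c k)
        = X $$ (a, b) * (V k $$ (i, a) * cnj (V k $$ (j, b)))" if "a < d" "b < d" for a b
      unfolding scaled[OF that, symmetric] by (simp only: mult_ac)
    have "(U k * X * mat_adjoint (U k)) $$ (i, j) * complex_of_real (c k)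
        = (V k * X * mat_adjoint (V k)) $$ (i, j)"
      unfolding index_conjugation[OF U X ij] index_conjugation[OF V X ij] sum_distrib_right
      by (intro sum.cong refl summand) auto
    from this[symmetric] show ?thesis by (simp only: of_real_mult of_real_of_nat_eq mult_ac)
  qed
  have kraus: "\<Phi> X $$ (i, j)
      = (\<Sum>k<K. complex_of_real (real d * c k) * (U k * X * mat_adjoint (U k)) $$ (i, j))"
    if X: "X \<in> carrier_mat d d" and ij: "i < d" "j < d" for X i j
    unfolding kraus_if_choi_factor[OF M \<rho> X ij]
    by (intro sum.cong refl) (simp only: lessThan_iff conj[OF _ X ij] V_def)
  \<comment> \<open>Each U_k fixes the identity under conjugation, so the (0, 0) entry of \<Phi>(1)
    = 1 is the sum of the weights.\<close>
  have "complex_of_real 1 = \<Phi> (1\<^sub>m d) $$ (0, 0)" using un d by (simp add: unital_def)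
  also have "\<dots> = (\<Sum>k<K. complex_of_real (real d * c k))"
  proof -
    have "U k * 1\<^sub>m d * mat_adjoint (U k) = 1\<^sub>m d" if "k < K" for k
      using unitary[OF that] U[of k] by (simp add: unitary_mat_def)
    then show ?thesis
      using kraus[of "1\<^sub>m d" 0 0] d by simp
  qed
  finally have "(\<Sum>k<K. real d * c k) = 1"
    by (metis of_real_eq_iff of_real_sum)
  moreover have "\<Phi> X = mat d d (\<lambda>(r, s). \<Sum>k<K. complex_of_real (real d * c k)
      * (U k * X * mat_adjoint (U k)) $$ (r, s))" if X: "X \<in> carrier_mat d d" for X
  proof -
    have "\<Phi> X \<in> carrier_mat d d" using lin X by (simp add: linear_mat_map_def)
    then show ?thesis
      using kraus[OF X] by (intro eq_matI) (auto simp del: index_mult_mat(1))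
  qed
  ultimately show ?thesis
    unfolding random_unitary_def using unitary c0
    by (intro exI[of _ K] exI[of _ "\<lambda>k. real d * c k"] exI[of _ U]) auto
qed

lemma choi_factor_if_random_unitary:
  assumes "random_unitary d \<Phi>"
  obtains M m where "M \<in> carrier_mat (d * d) m" "choi d \<Phi> = M * mat_adjoint M"
    "\<And>k. k < m \<Longrightarrow> \<exists>c. unvec_col d M k * mat_adjoint (unvec_col d M k) = c \<cdot>\<^sub>m 1\<^sub>m d"
proof -
  obtain m :: nat and p :: "nat \<Rightarrow> real" and U
    where p: "\<And>k. k < m \<Longrightarrow> 0 \<le> p k" and U: "\<And>k. k < m \<Longrightarrow> unitary_mat d (U k)"
    and \<Phi>: "\<And>X. X \<in> carrier_mat d d \<Longrightarrow> \<Phi> X =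
      mat d d (\<lambda>(r, s). \<Sum>k<m. complex_of_real (p k) * (U k * X * mat_adjoint (U k)) $$ (r, s))"
    using assms unfolding random_unitary_def by blast
  have Uc: "U k \<in> carrier_mat d d" if "k < m" for k using U[OF that] by (simp add: unitary_mat_def)
  \<comment> \<open>The columns of M are the reshaped unitaries scaled by sqrt(p_k / d): the root
    because M occurs twice in M M', the 1/d to match the normalised Choi matrix.\<close>
  define q where "q k = complex_of_real (sqrt (p k / real d))" for k
  have q: "q k * cnj (q k) = complex_of_real (p k) / of_nat d" if "k < m" for k
  proof -
    have "q k * cnj (q k) = complex_of_real (sqrt (p k / real d) * sqrt (p k / real d))"
      by (simp only: q_def complex_cnj_complex_of_real of_real_mult)
    also have "sqrt (p k / real d) * sqrt (p k / real d) = p k / real d"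
      using p[OF that] by simp
    finally show ?thesis by simp
  qed
  define M where "M = mat (d * d) m (\<lambda>(r, k). q k * U k $$ (r div d, r mod d))"
  have M: "M \<in> carrier_mat (d * d) m" by (simp add: M_def)
  have Mi: "M $$ (i * d + a, k) = q k * U k $$ (i, a)" if "i < d" "a < d" "k < m" for i a k
    using that by (simp add: M_def pair_index_less)
  have "choi d \<Phi> = M * mat_adjoint M"
  proof (rule eq_matI)
    fix r s assume "r < dim_row (M * mat_adjoint M)" "s < dim_col (M * mat_adjoint M)"
    then have rs: "r < d * d" "s < d * d" using M by auto
    define i a j b where "i = r div d" and "a = r mod d" and "j = s div d" and "b = s mod d"
    have "0 < d" using rs by (cases d) auto
    then have lt: "i < d" "a < d" "j < d" "b < d"
      using rs by (auto simp: i_def a_def j_def b_def less_mult_imp_div_less)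
    have r: "r = i * d + a" and s: "s = j * d + b" by (simp_all add: i_def a_def j_def b_def)
    have conj: "(U k * mat_unit d a b * mat_adjoint (U k)) $$ (i, j) = U k $$ (i, a) * cnj (U k $$ (j, b))"
      if "k < m" for k
    proof -
      have "(U k * mat_unit d a b * mat_adjoint (U k)) $$ (i, j)
          = (\<Sum>a'<d. \<Sum>b'<d. (if b' = b \<and> a' = a then 1 else 0) * (U k $$ (i, a') * cnj (U k $$ (j, b'))))"
        unfolding index_conjugation[OF Uc[OF that] mat_unit_carrier lt(1,3)]
        by (intro sum.cong refl) (auto simp: mat_unit_def)
      also have "\<dots> = U k $$ (i, a) * cnj (U k $$ (j, b))"
        using lt by (subst sum_single_entry) auto
      finally show ?thesis .
    qed
    have "choi d \<Phi> $$ (r, s) = (\<Sum>k<m. complex_of_real (p k) * (U k $$ (i, a) * cnj (U k $$ (j, b)))) / of_nat d"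
      using lt conj unfolding r s index_choi[OF lt]
      by (simp add: \<Phi>[OF mat_unit_carrier] del: index_mult_mat(1))
    also have "\<dots> = (\<Sum>k<m. (q k * cnj (q k)) * (U k $$ (i, a) * cnj (U k $$ (j, b))))"
      by (simp add: q sum_divide_distrib)
    also have "\<dots> = (\<Sum>k<m. (q k * U k $$ (i, a)) * cnj (q k * U k $$ (j, b)))"
      by (simp add: mult_ac)
    also have "\<dots> = (\<Sum>k<m. M $$ (r, k) * cnj (M $$ (s, k)))"
      using lt by (simp add: r s Mi)
    also have "\<dots> = (M * mat_adjoint M) $$ (r, s)"
      by (rule index_mult_adjoint[OF M M rs, symmetric])
    finally show "choi d \<Phi> $$ (r, s) = (M * mat_adjoint M) $$ (r, s)" .
  qed (use M in \<open>auto simp: choi_def tensor_id_def\<close>)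
  moreover have "unvec_col d M k * mat_adjoint (unvec_col d M k) = (q k * cnj (q k)) \<cdot>\<^sub>m 1\<^sub>m d"
    if k: "k < m" for k
  proof (rule eq_matI)
    fix i j assume "i < dim_row ((q k * cnj (q k)) \<cdot>\<^sub>m 1\<^sub>m d)" "j < dim_col ((q k * cnj (q k)) \<cdot>\<^sub>m 1\<^sub>m d)"
    then have ij: "i < d" "j < d" by auto
    have "(unvec_col d M k * mat_adjoint (unvec_col d M k)) $$ (i, j)
        = (q k * cnj (q k)) * (U k * mat_adjoint (U k)) $$ (i, j)"
      using ij k
      by (simp add: index_mult_adjoint[OF unvec_col_carrier unvec_col_carrier]
          index_mult_adjoint[OF Uc Uc] Mi sum_distrib_left del: index_mult_mat(1))
        (simp only: mult_ac)
    then show "(unvec_col d M k * mat_adjoint (unvec_col d M k)) $$ (i, j)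
        = ((q k * cnj (q k)) \<cdot>\<^sub>m 1\<^sub>m d) $$ (i, j)"
      using U[OF k] ij by (simp add: unitary_mat_def)
  qed (simp_all add: unvec_col_def)
  ultimately show ?thesis using that M by blast
qed

end

section \<open>The equivalence, read through factorisations of the Choi matrix\<close>

theorem mainTheorem1:
  fixes d :: nat and \<Phi> :: "complex mat \<Rightarrow> complex mat" and \<tau> :: "nat \<Rightarrow> complex mat"
    and \<rho> :: "complex mat" and A :: "nat \<Rightarrow> complex mat"
  assumes d: "d \<ge> 2"
    and \<tau>: "bij_betw \<tau> {1..d\<^sup>2 - 1} (gell_mann d)"
    and lin: "linear_mat_map d \<Phi>"
    and cp: "completely_positive d \<Phi>"
    and tp: "trace_preserving d \<Phi>"
    and un: "unital d \<Phi>"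
    and \<rho>: "\<rho> = choi d \<Phi>"
    and A: "\<And>i. i \<in> {1..d\<^sup>2 - 1} \<Longrightarrow> A i = psd_sqrt \<rho> * kron (\<tau> i) (1\<^sub>m d) * psd_sqrt \<rho>"
  shows "random_unitary d \<Phi> \<longleftrightarrow>
    (\<exists>K T. K \<ge> d\<^sup>2 \<and> T \<in> carrier_mat (d\<^sup>2) K \<and> right_unitary T \<and>
       (\<forall>i \<in> {1..d\<^sup>2 - 1}. \<forall>j<K. (mat_adjoint T * A i * T) $$ (j, j) = 0))"
proof -
  define S where "S = psd_sqrt \<rho>"
  have S: "S \<in> carrier_mat (d * d) (d * d)" "mat_adjoint S = S" and SS: "S * S = \<rho>"
    using psd_sqrt[OF choi_psd[OF cp]] by (auto simp: S_def \<rho> psd_mat_def)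
  have \<tau>c: "\<tau> i \<in> gell_mann d" if "i \<in> {1..d\<^sup>2 - 1}" for i
    using \<tau> that by (auto simp: bij_betw_def)
  have diag: "(mat_adjoint T * A i * T) $$ (j, j) = (\<Sum>l<d. \<Sum>k<d. \<tau> i $$ (k, l)
      * (unvec_col d (S * T) j * mat_adjoint (unvec_col d (S * T) j)) $$ (l, k))"
    if T: "T \<in> carrier_mat (d * d) K" and i: "i \<in> {1..d\<^sup>2 - 1}" and j: "j < K" for T K i j
  proof -
    let ?k = "kron (\<tau> i) (1\<^sub>m d)"
    have k: "?k \<in> carrier_mat (d * d) (d * d)"
      using gell_mann_carrier[OF \<tau>c[OF i]] by (auto simp: kron_def)
    \<comment> \<open>As S is Hermitian, the two outer factors S of \<open>A i\<close> are absorbed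
      into S T and its adjoint.\<close>
    have "mat_adjoint T * A i * T = mat_adjoint (S * T) * ?k * (S * T)"
      using T S k
      by (simp add: A[OF i] S_def[symmetric] mat_adjoint_mult[of _ "d * d" "d * d" _ K]
          assoc_mult_mat[of _ "d * d" "d * d" _ "d * d" _ "d * d"]
          assoc_mult_mat[of _ K "d * d" _ "d * d" _ "d * d"]
          assoc_mult_mat[of _ K "d * d" _ "d * d" _ K]
          assoc_mult_mat[of _ "d * d" "d * d" _ "d * d" _ K]
          mult_carrier_mat[of _ "d * d" "d * d" _ "d * d"]
          mult_carrier_mat[of _ K "d * d" _ "d * d"]
          mult_carrier_mat[of _ "d * d" "d * d" _ K])
    then show ?thesis
      using diag_conjugated_kron[OF mult_carrier_mat[OF S(1) T] gell_mann_carrier[OF \<tau>c[OF i]] j]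
      by simp
  qed
  show ?thesis
  proof
    assume "random_unitary d \<Phi>"
    then obtain M m where M: "M \<in> carrier_mat (d * d) m" and \<rho>M: "choi d \<Phi> = M * mat_adjoint M"
      and scalar: "\<And>k. k < m \<Longrightarrow> \<exists>c. unvec_col d M k * mat_adjoint (unvec_col d M k) = c \<cdot>\<^sub>m 1\<^sub>m d"
      using choi_factor_if_random_unitary[OF lin] by blast
    obtain T where T: "T \<in> carrier_mat (d * d) (m + d * d)" and rT: "right_unitary T"
      and ST: "\<And>i j. i < d * d \<Longrightarrow> j < m + d * d \<Longrightarrow>
        (S * T) $$ (i, j) = (if j < m then M $$ (i, j) else 0)"
      using right_unitary_factor[OF S M] SS \<rho>M \<rho> by metis
    have "(mat_adjoint T * A i * T) $$ (j, j) = 0"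
      if i: "i \<in> {1..d\<^sup>2 - 1}" and j: "j < m + d * d" for i j
    proof -
      have "\<exists>c. unvec_col d (S * T) j * mat_adjoint (unvec_col d (S * T) j) = c \<cdot>\<^sub>m 1\<^sub>m d"
      proof (cases "j < m")
        case True
        then have "unvec_col d (S * T) j = unvec_col d M j"
          using ST j by (intro eq_matI) (auto simp: unvec_col_def pair_index_less simp del: index_mult_mat(1))
        then show ?thesis using scalar[OF True] by simp
      next
        case False
        \<comment> \<open>A padded column reshapes to the zero matrix, which is covered by the
          scalar 0.\<close>
        then have "unvec_col d (S * T) j = 0\<^sub>m d d"
          using ST j by (intro eq_matI) (auto simp: unvec_col_def pair_index_less simp del: index_mult_mat(1))
        then show ?thesis by (intro exI[of _ 0]) (auto intro!: eq_matI)
      qed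
      then obtain c where c: "unvec_col d (S * T) j * mat_adjoint (unvec_col d (S * T) j) = c \<cdot>\<^sub>m 1\<^sub>m d"
        by blast
      \<comment> \<open>For V_j V_j' = c 1 the trace formula gives c Tr(tau_i), and the tau_i are
        traceless.\<close>
      have "(mat_adjoint T * A i * T) $$ (j, j)
          = (\<Sum>l<d. \<Sum>k<d. if k = l then \<tau> i $$ (l, l) * c else 0)"
        unfolding diag[OF T i j] c by (intro sum.cong refl) auto
      also have "\<dots> = (\<Sum>l<d. \<tau> i $$ (l, l)) * c" by (simp add: sum_distrib_right)
      finally show ?thesis by (simp add: gell_mann_traceless[OF \<tau>c[OF i]])
    qed
    then show "\<exists>K T. K \<ge> d\<^sup>2 \<and> T \<in> carrier_mat (d\<^sup>2) K \<and> right_unitary T \<and>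
       (\<forall>i \<in> {1..d\<^sup>2 - 1}. \<forall>j<K. (mat_adjoint T * A i * T) $$ (j, j) = 0)"
      using T rT by (intro exI[of _ "m + d * d"] exI[of _ T]) (auto simp: power2_eq_square)
  next
    assume "\<exists>K T. K \<ge> d\<^sup>2 \<and> T \<in> carrier_mat (d\<^sup>2) K \<and> right_unitary T \<and>
       (\<forall>i \<in> {1..d\<^sup>2 - 1}. \<forall>j<K. (mat_adjoint T * A i * T) $$ (j, j) = 0)"
    then obtain K T where T: "T \<in> carrier_mat (d * d) K" and rT: "right_unitary T"
      and zero: "\<And>i j. i \<in> {1..d\<^sup>2 - 1} \<Longrightarrow> j < K \<Longrightarrow> (mat_adjoint T * A i * T) $$ (j, j) = 0"
      by (auto simp: power2_eq_square)
    have TT: "T * mat_adjoint T = 1\<^sub>m (d * d)" using rT T by (auto simp: right_unitary_def)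
    have ST: "S * T \<in> carrier_mat (d * d) K" using S T by auto
    \<comment> \<open>Right-unitarity cancels T T' in the middle, so S T is again a factor of the
      Choi matrix.\<close>
    have "(S * T) * mat_adjoint (S * T) = S * (T * mat_adjoint T) * S"
      using S T by (simp add: mat_adjoint_mult[of _ "d * d" "d * d" _ K]
          assoc_mult_mat[of _ "d * d" "d * d" _ K _ "d * d"]
          assoc_mult_mat[of _ "d * d" K _ "d * d" _ "d * d"]
          assoc_mult_mat[of _ "d * d" "d * d" _ "d * d" _ "d * d"]
          mult_carrier_mat[of _ "d * d" K _ "d * d"] mult_carrier_mat[of _ K "d * d" _ "d * d"])
    then have factor: "choi d \<Phi> = (S * T) * mat_adjoint (S * T)"
      using S SS by (simp add: TT \<rho> right_mult_one_mat[of _ "d * d" "d * d"])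
    show "random_unitary d \<Phi>"
    proof (rule random_unitary_if_choi_factor[OF lin _ un ST factor])
      fix k r s assume k: "k < K" and rs: "r < d" "s < d"
      have "(\<Sum>j<d. \<Sum>i<d. B $$ (i, j)
          * (unvec_col d (S * T) k * mat_adjoint (unvec_col d (S * T) k)) $$ (j, i)) = 0"
        if "B \<in> gell_mann d" for B
      proof -
        have "B \<in> \<tau> ` {1..d\<^sup>2 - 1}" using that bij_betw_imp_surj_on[OF \<tau>] by simp
        then obtain i where i: "B = \<tau> i" "i \<in> {1..d\<^sup>2 - 1}" by (rule imageE)
        then show ?thesis using diag[OF T i(2) k] zero[OF i(2) k] by simp
      qed
      from scalar_if_orthogonal_to_gell_mann[OF this rs]
      show "(unvec_col d (S * T) k * mat_adjoint (unvec_col d (S * T) k)) $$ (r, s)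
          = (if r = s then (unvec_col d (S * T) k * mat_adjoint (unvec_col d (S * T) k)) $$ (0, 0) else 0)"
        by simp
    qed (use d in simp)
  qed
qed

end
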